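(* Let $x,y\in\mathsf X=\mathsf Z^T$ and $N\ge2$. Let $\mathbb E^N_{\mathbf 1,x,\mathbf 2,y}$ be the expectation for the doubly conditional SMC process with fixed paths $x$ (lineage $\mathbf 1=(1,\dots,1)$) and $y$ (lineage $\mathbf 2=(2,\dots,2)$), and let $\hat\gamma_T^N(z_{1:T}):=\prod_{t=1}^T\frac1N\sum_{j=1}^NG_t(z_t^j)$. Then $$\mathbb E^N_{\mathbf 1,x,\mathbf 2,y}\big[\hat\gamma_T^N(Z_{1:T})\big]=\frac1{N^T}\sum_{s=1}^{T+1}(N-2)^{T+1-s}\sum_{0<i_1<\cdots<i_s=T+1}G_{0,i_1}\prod_{m=1}^{s-1}\big[G_{i_m,i_{m+1}}(x_{i_m})+G_{i_m,i_{m+1}}(y_{i_m})\big],$$ where the inner sum is over integers $i_1,\dots,i_s$ with $0<i_1<\cdots<i_{s-1}<i_s=T+1$, and $\prod_\emptyset=1$, $0^0=1$.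
   Context: Setting. $[N]:=\{1,\dots,N\}$; $(\mathsf Z,\mathcal B(\mathsf Z))$ measurable space, $T\ge1$; $M_1$ a probability on $\mathsf Z$, $M_t$ ($2\le t\le T$) Markov kernels on $\mathsf Z$, $G_t:\mathsf Z\to[0,\infty)$ ($t\in[T]$) measurable. Let $(Z_t)$ be, under $\mathbb P$, the Markov chain with $Z_1\sim M_1$ and transition $M_t(Z_{t-1},\cdot)$ at time $t$. For $1\le p<q\le T+1$, $G_{p,q}(z):=\mathbb E[\prod_{k=p}^{q-1}G_k(Z_k)\mid Z_p=z]$ (so $G_{p,p+1}=G_p$); $G_{0,1}:=1$ and, for $2\le q\le T+1$, $G_{0,q}:=\mathbb E[\prod_{k=1}^{q-1}G_k(Z_k)]$. It is assumed $0<\mathbb E[\prod_{t=1}^TG_t(Z_t)]<\infty$. Doubly conditional SMC (c$^2$SMC) process with lineages $\mathbf 1$, $\mathbf 2$. Generate $Z_t=(Z_t^1,\dots,Z_t^N)\in\mathsf Z^N$ and $A_{t}\in[N]^N$ as follows: $Z_1^1=x_1$, $Z_1^2=y_1$ and $Z_1^3,\dots,Z_1^N$ i.i.d. $M_1$; for $2\le t\le T$, given the past (depending only on $Z_{t-1}$), $Z_t^1=x_t$, $Z_t^2=y_t$, $A_{t-1}^1=1$, $A_{t-1}^2=2$, and independently for $i=3,\dots,N$, $A_{t-1}^i=l$ with probability $G_{t-1}(Z_{t-1}^l)/\sum_{j=1}^NG_{t-1}(Z_{t-1}^j)$ and then $Z_t^i\sim M_t(Z_{t-1}^{A_{t-1}^i},\cdot)$.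 Convention: if a denominator is zero the index $1$ is selected. *)

theory Defs
  imports "HOL-Probability.Probability"
begin

(* Law of (Z_p, ..., Z_(p+n)), as a measure on functions on the index set {p..p+n}, for the
   Markov chain with Z_p distributed according to D and Z_t ~ M t (Z_(t-1)) for t > p. *)
primrec chain_law ::
  "'a measure \<Rightarrow> (nat \<Rightarrow> 'a \<Rightarrow> 'a measure) \<Rightarrow> nat \<Rightarrow> 'a measure \<Rightarrow> nat \<Rightarrow> (nat \<Rightarrow> 'a) measure" where
  "chain_law S M p D 0 = distr D (\<Pi>\<^sub>M k\<in>{p..p}. S) (\<lambda>z. \<lambda>k\<in>{p..p}. z)"
| "chain_law S M p D (Suc n) =
     chain_law S M p D n \<bind>
       (\<lambda>w. distr (M (p + Suc n) (w (p + n))) (\<Pi>\<^sub>M k\<in>{p..p + Suc n}. S) (\<lambda>z. w(p + Suc n := z)))"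

(* The conditional expectation of the product of G k (Z_k), p <= k < q, given Z_p = z, in the
   version determined at every point z by the kernels: the chain is started from the Dirac
   measure at z.  The value may be infinite. *)
definition G_between ::
  "'a measure \<Rightarrow> (nat \<Rightarrow> 'a \<Rightarrow> 'a measure) \<Rightarrow> (nat \<Rightarrow> 'a \<Rightarrow> real) \<Rightarrow> nat \<Rightarrow> nat \<Rightarrow> nat \<Rightarrow> 'a \<Rightarrow> ennreal" where
  "G_between S M G T p q z =
     (\<integral>\<^sup>+w. ennreal (\<Prod>k\<in>{p..<q}. G k (w k)) \<partial>chain_law S M p (return S z) (T - p))"

definition G_initial ::
  "'a measure \<Rightarrow> 'a measure \<Rightarrow> (nat \<Rightarrow> 'a \<Rightarrow> 'a measure) \<Rightarrow> (nat \<Rightarrow> 'a \<Rightarrow> real) \<Rightarrow> nat \<Rightarrow> nat \<Rightarrow> ennreal" where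
  "G_initial S M1 M G T q =
     (if q = 1 then 1
      else \<integral>\<^sup>+w. ennreal (\<Prod>k\<in>{1..<q}. G k (w k)) \<partial>chain_law S M 1 M1 (T - 1))"

(* Law of one ancestor index, g l being the unnormalised weight of particle l. *)
definition ancestor_law :: "nat \<Rightarrow> (nat \<Rightarrow> real) \<Rightarrow> nat measure" where
  "ancestor_law N g =
     point_measure {1..N}
       (\<lambda>l. ennreal (if (\<Sum>j\<in>{1..N}. g j) = 0 then (if l = 1 then 1 else 0)
                     else g l / (\<Sum>j\<in>{1..N}. g j)))"

definition c2smc_init :: "nat \<Rightarrow> 'a measure \<Rightarrow> 'a measure \<Rightarrow> 'a \<Rightarrow> 'a \<Rightarrow> (nat \<Rightarrow> 'a) measure" where
  "c2smc_init N S M1 a b =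
     (\<Pi>\<^sub>M i\<in>{1..N}. if i = 1 then return S a else if i = 2 then return S b else M1)"

(* Joint law of the pairs (A_(t-1)^i, Z_t^i), independent over i, given Z_(t-1) = z, where g and K
   are the potential at time t-1 and the kernel at time t, and a, b the imposed states at time t. *)
definition c2smc_step ::
  "nat \<Rightarrow> 'a measure \<Rightarrow> ('a \<Rightarrow> real) \<Rightarrow> ('a \<Rightarrow> 'a measure) \<Rightarrow> 'a \<Rightarrow> 'a \<Rightarrow> (nat \<Rightarrow> 'a)
     \<Rightarrow> (nat \<Rightarrow> nat \<times> 'a) measure" where
  "c2smc_step N S g K a b z =
     (\<Pi>\<^sub>M i\<in>{1..N}.
        if i = 1 then return (count_space {1..N} \<Otimes>\<^sub>M S) (1, a)
        else if i = 2 then return (count_space {1..N} \<Otimes>\<^sub>M S) (2, b)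
        else ancestor_law N (\<lambda>l. g (z l)) \<bind>
               (\<lambda>l. distr (K (z l)) (count_space {1..N} \<Otimes>\<^sub>M S) (Pair l)))"

(* Measurable space of the particles Z_1, ..., Z_t and the ancestors A_1, ..., A_(t-1). *)
definition history_space ::
  "nat \<Rightarrow> 'a measure \<Rightarrow> nat \<Rightarrow> ((nat \<Rightarrow> nat \<Rightarrow> 'a) \<times> (nat \<Rightarrow> nat \<Rightarrow> nat)) measure" where
  "history_space N S t =
     (\<Pi>\<^sub>M k\<in>{1..t}. \<Pi>\<^sub>M i\<in>{1..N}. S) \<Otimes>\<^sub>M (\<Pi>\<^sub>M k\<in>{1..<t}. \<Pi>\<^sub>M i\<in>{1..N}. count_space {1..N})"

(* Law of the doubly conditional SMC process up to time n + 1. *)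
primrec c2smc_upto ::
  "nat \<Rightarrow> 'a measure \<Rightarrow> 'a measure \<Rightarrow> (nat \<Rightarrow> 'a \<Rightarrow> 'a measure) \<Rightarrow> (nat \<Rightarrow> 'a \<Rightarrow> real)
     \<Rightarrow> (nat \<Rightarrow> 'a) \<Rightarrow> (nat \<Rightarrow> 'a) \<Rightarrow> nat
     \<Rightarrow> ((nat \<Rightarrow> nat \<Rightarrow> 'a) \<times> (nat \<Rightarrow> nat \<Rightarrow> nat)) measure" where
  "c2smc_upto N S M1 M G x y 0 =
     distr (c2smc_init N S M1 (x 1) (y 1)) (history_space N S 1)
       (\<lambda>z. (\<lambda>k\<in>{1..1}. z, \<lambda>k. undefined))"
| "c2smc_upto N S M1 M G x y (Suc n) =
     c2smc_upto N S M1 M G x y n \<bind>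
       (\<lambda>(Z, A).
          distr (c2smc_step N S (G (n + 1)) (M (n + 2)) (x (n + 2)) (y (n + 2)) (Z (n + 1)))
            (history_space N S (n + 2))
            (\<lambda>u. (Z(n + 2 := \<lambda>i\<in>{1..N}. snd (u i)), A(n + 1 := \<lambda>i\<in>{1..N}. fst (u i)))))"

definition c2smc_law ::
  "nat \<Rightarrow> nat \<Rightarrow> 'a measure \<Rightarrow> 'a measure \<Rightarrow> (nat \<Rightarrow> 'a \<Rightarrow> 'a measure) \<Rightarrow> (nat \<Rightarrow> 'a \<Rightarrow> real)
     \<Rightarrow> (nat \<Rightarrow> 'a) \<Rightarrow> (nat \<Rightarrow> 'a)
     \<Rightarrow> ((nat \<Rightarrow> nat \<Rightarrow> 'a) \<times> (nat \<Rightarrow> nat \<Rightarrow> nat)) measure" where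
  "c2smc_law T N S M1 M G x y = c2smc_upto N S M1 M G x y (T - 1)"

definition gamma_hat :: "nat \<Rightarrow> nat \<Rightarrow> (nat \<Rightarrow> 'a \<Rightarrow> real) \<Rightarrow> (nat \<Rightarrow> nat \<Rightarrow> 'a) \<Rightarrow> real" where
  "gamma_hat T N G z = (\<Prod>t\<in>{1..T}. 1 / real N * (\<Sum>j\<in>{1..N}. G t (z t j)))"

(* Integer sequences 0 < i_1 < ... < i_s = T + 1, as functions on the index set {1..s}. *)
definition index_chains :: "nat \<Rightarrow> nat \<Rightarrow> (nat \<Rightarrow> nat) set" where
  "index_chains T s =
     {i \<in> {1..s} \<rightarrow>\<^sub>E {1..T + 1}. strict_mono_on {1..s} i \<and> i s = T + 1}"

end

theory Submission
  imports Defs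
begin

text \<open>
  The weights cancel the normalisation of the resampling step.  Write \<open>W\<^sub>t(z) = G\<^sub>t(z\<^sup>1) + ... + G\<^sub>t(z\<^sup>N)\<close>,
  and let \<open>h\<close> be a function of one state.  Given \<open>Z\<^sub>t = z\<close>, the sum of \<open>h\<close> over the particles at time
  \<open>t + 1\<close> has the two imposed terms \<open>h(x\<^sub>t\<^sub>+\<^sub>1) + h(y\<^sub>t\<^sub>+\<^sub>1)\<close> and \<open>N - 2\<close> terms of the same mean
  \<open>\<Sum>\<^sub>l G\<^sub>t(z\<^sup>l) M\<^sub>t\<^sub>+\<^sub>1h(z\<^sup>l) / W\<^sub>t(z)\<close>.  Multiplied by \<open>W\<^sub>t(z)\<close>, its mean is therefore again a sum over
  particles, \<open>\<Sum>\<^sub>l G\<^sub>t(z\<^sup>l) (h(x\<^sub>t\<^sub>+\<^sub>1) + h(y\<^sub>t\<^sub>+\<^sub>1) + (N - 2) M\<^sub>t\<^sub>+\<^sub>1h(z\<^sup>l))\<close>.  If \<open>W\<^sub>t(z) = 0\<close>, each \<open>G\<^sub>t(z\<^sup>l)\<close>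
  is zero and both sides vanish.

  Starting from \<open>G\<^sub>T\<close> and going back in time, this turns the expectation of \<open>W\<^sub>1 ... W\<^sub>T\<close> into
  \<open>H\<^sub>1(x\<^sub>1) + H\<^sub>1(y\<^sub>1) + (N - 2) M\<^sub>1H\<^sub>1\<close>, where \<open>H\<^sub>t\<close> solves the linear backward recursion
  \<open>H\<^sub>t = G\<^sub>t (H\<^sub>t\<^sub>+\<^sub>1(x\<^sub>t\<^sub>+\<^sub>1) + H\<^sub>t\<^sub>+\<^sub>1(y\<^sub>t\<^sub>+\<^sub>1) + (N - 2) M\<^sub>t\<^sub>+\<^sub>1H\<^sub>t\<^sub>+\<^sub>1)\<close> (\<open>future_weight\<close>; the computation is
  \<open>total_weight_times_expected_future_weight\<close> and \<open>expected_gamma_hat\<close>).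

  Expanding the recursion until the next time \<open>r\<close> at which an imposed state is chosen, and using
  \<open>G\<^sub>t\<^sub>,\<^sub>r = G\<^sub>t M\<^sub>t\<^sub>+\<^sub>1G\<^sub>t\<^sub>+\<^sub>1\<^sub>,\<^sub>r\<close> (\<open>G_between_first_step\<close>), one finds
  \<open>H\<^sub>t = \<Sum>\<^sub>r G\<^sub>t\<^sub>,\<^sub>r (N - 2)\<^bsup>r - t - 1\<^esup> D\<^sub>r\<close> with \<open>D\<^sub>r = H\<^sub>r(x\<^sub>r) + H\<^sub>r(y\<^sub>r)\<close> and \<open>D\<^sub>T\<^sub>+\<^sub>1 = 1\<close>
  (\<open>future_weight_eq_sum\<close>).  Hence \<open>D\<close> satisfies a renewal equation, whose solution is the sum over the
  sequences of renewal times \<open>i\<^sub>1 < ... < i\<^sub>s = T + 1\<close>; each of the times that such a sequence skips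
  contributes one factor \<open>N - 2\<close> (\<open>spaced_chain_sum_rec\<close>, \<open>sum_over_index_chains\<close>).

  Only sums, products and integrals of nonnegative quantities occur, so that everything holds in
  \<open>[0, \<infinity>]\<close>, including the cases where some \<open>G\<^sub>p\<^sub>,\<^sub>q\<close> is infinite at an imposed state.
\<close>

section \<open>Products of Markov kernels\<close>

lemma measurable_component_compose:
  assumes "i \<in> I" and "h \<in> R i \<rightarrow>\<^sub>M L"
  shows "(\<lambda>w. h (w i)) \<in> (\<Pi>\<^sub>M i\<in>I. R i) \<rightarrow>\<^sub>M L"
  using measurable_component_singleton[OF assms(1), of R] assms(2) by (rule measurable_compose)

text \<open>
  On the boxes, which generate the product space and are stable under intersection, the product
  measure is a finite product of measurable functions of the parameter.
\<close>

lemma measurable_PiM_kernel: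
  assumes "finite I" and K: "\<And>i. i \<in> I \<Longrightarrow> K i \<in> L \<rightarrow>\<^sub>M prob_algebra (R i)"
  shows "(\<lambda>z. \<Pi>\<^sub>M i\<in>I. K i z) \<in> L \<rightarrow>\<^sub>M prob_algebra (\<Pi>\<^sub>M i\<in>I. R i)"
proof (rule measurable_prob_algebra_generated)
  show "sets (\<Pi>\<^sub>M i\<in>I. R i) =
      sigma_sets (\<Pi>\<^sub>E i\<in>I. space (R i)) {Pi\<^sub>E I E | E. \<forall>i\<in>I. E i \<in> sets (R i)}"
    unfolding sets_PiM prod_algebra_eq_finite[OF \<open>finite I\<close>] by (simp add: Pi_iff) 
  show "Int_stable {Pi\<^sub>E I E | E. \<forall>i\<in>I. E i \<in> sets (R i)}"
    by (rule Int_stable_PiE)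
  show "{Pi\<^sub>E I E | E. \<forall>i\<in>I. E i \<in> sets (R i)} \<subseteq> Pow (\<Pi>\<^sub>E i\<in>I. space (R i))"
  proof clarify
    fix E f assume "\<forall>i\<in>I. E i \<in> sets (R i)" "f \<in> Pi\<^sub>E I E"
    then show "f \<in> (\<Pi>\<^sub>E i\<in>I. space (R i))"
      by (auto simp: PiE_iff dest: sets.sets_into_space)
  qed
next
  fix z assume z: "z \<in> space L"
  have K_z: "prob_space (K i z)" "sets (K i z) = sets (R i)" if "i \<in> I" for i
    using measurable_space[OF K[OF that] z] by (auto simp: space_prob_algebra)
  show "prob_space (\<Pi>\<^sub>M i\<in>I. K i z)"
    using K_z by (intro prob_space_PiM)
  show "sets (\<Pi>\<^sub>M i\<in>I. K i z) = sets (\<Pi>\<^sub>M i\<in>I. R i)"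
    using K_z by (intro sets_PiM_cong) auto
next
  fix X assume "X \<in> {Pi\<^sub>E I E | E. \<forall>i\<in>I. E i \<in> sets (R i)}"
  then obtain E where X: "X = Pi\<^sub>E I E" and E: "\<And>i. i \<in> I \<Longrightarrow> E i \<in> sets (R i)"
    by auto
  have K_sub: "K i \<in> L \<rightarrow>\<^sub>M subprob_algebra (R i)" if "i \<in> I" for i
    using K[OF that] by (rule measurable_prob_algebraD)
  have "emeasure (\<Pi>\<^sub>M i\<in>I. K i z) X = (\<Prod>i\<in>I. emeasure (K i z) (E i))" if z: "z \<in> space L" for z
  proof -
    have K_z: "prob_space (K i z)" "sets (K i z) = sets (R i)" if "i \<in> I" for i
      using measurable_space[OF K[OF that] z] by (auto simp: space_prob_algebra)
    have "emeasure (\<Pi>\<^sub>M i\<in>I. K i z) (prod_emb I (\<lambda>i. K i z) I (Pi\<^sub>E I E)) =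
        (\<Prod>i\<in>I. emeasure (K i z) (E i))"
      using K_z E \<open>finite I\<close> by (intro emeasure_PiM_emb) auto
    moreover have "prod_emb I (\<lambda>i. K i z) I (Pi\<^sub>E I E) = Pi\<^sub>E I E"
      using E[THEN sets.sets_into_space] sets_eq_imp_space_eq[OF K_z(2)]
      by (intro prod_emb_id PiE_mono) auto
    ultimately show ?thesis
      by (simp add: X)
  qed
  then show "(\<lambda>z. emeasure (\<Pi>\<^sub>M i\<in>I. K i z) X) \<in> borel_measurable L"
    using measurable_emeasure_kernel[OF K_sub E]
    by (subst measurable_cong) (auto intro!: borel_measurable_prod_ennreal)
qed

lemma nn_integral_PiM_component:
  assumes "\<And>i. i \<in> I \<Longrightarrow> prob_space (M i)" and "i \<in> I" and "f \<in> borel_measurable (M i)"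
  shows "(\<integral>\<^sup>+u. f (u i) \<partial>(\<Pi>\<^sub>M i\<in>I. M i)) = (\<integral>\<^sup>+v. f v \<partial>M i)"
proof -
  have "(\<integral>\<^sup>+v. f v \<partial>distr (\<Pi>\<^sub>M i\<in>I. M i) (M i) (\<lambda>u. u i)) = (\<integral>\<^sup>+u. f (u i) \<partial>(\<Pi>\<^sub>M i\<in>I. M i))"
    using assms by (intro nn_integral_distr) auto
  then show ?thesis
    by (simp only: distr_PiM_component[where I = I and M = M and i = i, OF assms(1,2)])
qed

section \<open>One step of the particle system\<close>

lemma sum_first_two_and_others:
  fixes f :: "nat \<Rightarrow> 'b :: comm_semiring_1"
  assumes "2 \<le> N" and others: "\<And>i. i \<in> {3..N} \<Longrightarrow> f i = c"
  shows "(\<Sum>i\<in>{1..N}. f i) = f 1 + f 2 + of_nat (N - 2) * c"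
proof -
  have "{1..N} = insert 1 (insert 2 {3..N})"
    using assms(1) by auto
  then have "(\<Sum>i\<in>{1..N}. f i) = f 1 + (f 2 + (\<Sum>i\<in>{3..N}. f i))"
    by simp
  also have "(\<Sum>i\<in>{3..N}. f i) = of_nat (N - 2) * c"
    using others by (simp add: numeral_3_eq_3 Suc_diff_Suc eval_nat_numeral)
  finally show ?thesis
    by (simp add: add.assoc)
qed

lemma space_ancestor_law [simp]: "space (ancestor_law N g) = {1..N}"
  and sets_ancestor_law [simp]: "sets (ancestor_law N g) = Pow {1..N}"
  by (simp_all add: ancestor_law_def space_point_measure sets_point_measure)

lemma prob_space_ancestor_law:
  assumes "1 \<le> N" and g: "\<And>l. l \<in> {1..N} \<Longrightarrow> 0 \<le> g l"
  shows "prob_space (ancestor_law N g)"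
proof (cases "(\<Sum>j\<in>{1..N}. g j) = 0")
  case True
  have "(\<Sum>l\<in>{1..N}. ennreal (if l = 1 then 1 else 0)) = (\<Sum>l\<in>{1..N}. if l = 1 then 1 else 0)"
    by (rule sum.cong) auto
  also have "\<dots> = 1"
    using assms(1) by (subst sum.delta) auto
  finally show ?thesis
    unfolding ancestor_law_def using True
    by (intro prob_spaceI) (simp add: space_point_measure emeasure_point_measure_finite)
next
  case False
  have "0 \<le> (\<Sum>j\<in>{1..N}. g j)"
    using g by (intro sum_nonneg) auto
  then have "(\<Sum>l\<in>{1..N}. ennreal (g l / (\<Sum>j\<in>{1..N}. g j))) = ennreal (\<Sum>l\<in>{1..N}. g l / (\<Sum>j\<in>{1..N}. g j))"
    using g by (intro sum_ennreal) auto
  also have "\<dots> = 1"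
    using False by (simp flip: sum_divide_distrib)
  finally show ?thesis
    unfolding ancestor_law_def using False
    by (intro prob_spaceI) (simp add: space_point_measure emeasure_point_measure_finite)
qed

lemma measurable_ancestor_law:
  assumes "1 \<le> N" and g: "g \<in> borel_measurable S" "\<And>z. z \<in> space S \<Longrightarrow> 0 \<le> g z"
  shows "(\<lambda>z. ancestor_law N (\<lambda>l. g (z l))) \<in> (\<Pi>\<^sub>M i\<in>{1..N}. S) \<rightarrow>\<^sub>M prob_algebra (count_space {1..N})"
proof (intro measurable_prob_algebraI measurable_subprob_algebra)
  fix z assume z: "z \<in> space (\<Pi>\<^sub>M i\<in>{1..N}. S)"
  then show prob: "prob_space (ancestor_law N (\<lambda>l. g (z l)))"
    using assms by (intro prob_space_ancestor_law) (auto simp: space_PiM PiE_iff)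
  then show "subprob_space (ancestor_law N (\<lambda>l. g (z l)))"
    by (rule prob_space_imp_subprob_space)
next
  fix A assume "A \<in> sets (count_space {1..N})"
  then have A: "A \<subseteq> {1..N}" by simp
  have weight: "(\<lambda>z. g (z l)) \<in> borel_measurable (\<Pi>\<^sub>M i\<in>{1..N}. S)" if "l \<in> {1..N}" for l
    by (rule measurable_component_compose[OF that g(1)])
  have total: "(\<lambda>z. \<Sum>j\<in>{1..N}. g (z j)) \<in> borel_measurable (\<Pi>\<^sub>M i\<in>{1..N}. S)"
    by (rule borel_measurable_sum) (rule weight)
  have "(\<lambda>z. \<Sum>l\<in>A. ennreal (if (\<Sum>j\<in>{1..N}. g (z j)) = 0 then (if l = 1 then 1 else 0)
      else g (z l) / (\<Sum>j\<in>{1..N}. g (z j)))) \<in> borel_measurable (\<Pi>\<^sub>M i\<in>{1..N}. S)"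
  proof (rule borel_measurable_sum)
    fix l assume "l \<in> A"
    then have [measurable]: "(\<lambda>z. g (z l)) \<in> borel_measurable (\<Pi>\<^sub>M i\<in>{1..N}. S)"
      using A weight by auto
    note total [measurable]
    show "(\<lambda>z. ennreal (if (\<Sum>j\<in>{1..N}. g (z j)) = 0 then (if l = 1 then 1 else 0)
      else g (z l) / (\<Sum>j\<in>{1..N}. g (z j)))) \<in> borel_measurable (\<Pi>\<^sub>M i\<in>{1..N}. S)"
      by measurable
  qed
  then show "(\<lambda>z. emeasure (ancestor_law N (\<lambda>l. g (z l))) A) \<in> borel_measurable (\<Pi>\<^sub>M i\<in>{1..N}. S)"
    unfolding ancestor_law_def by (simp only: emeasure_point_measure_finite[OF _ A] finite_atLeastAtMost)
qed simp

text \<open>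
  The cancellation on which everything rests: the random normalising constant of the ancestor
  distribution disappears.  If the total weight is zero, each single weight is zero as well, and both
  sides are zero, because \<open>0 * \<infinity> = 0\<close> in \<open>ennreal\<close>.
\<close>

lemma total_weight_times_ancestor_mean:
  fixes \<phi> :: "nat \<Rightarrow> ennreal"
  assumes g: "\<And>l. l \<in> {1..N} \<Longrightarrow> 0 \<le> g l"
  shows "(\<Sum>j\<in>{1..N}. ennreal (g j)) * (\<integral>\<^sup>+l. \<phi> l \<partial>ancestor_law N g) =
    (\<Sum>l\<in>{1..N}. ennreal (g l) * \<phi> l)"
proof -
  let ?s = "\<Sum>j\<in>{1..N}. g j"
  have s: "(\<Sum>j\<in>{1..N}. ennreal (g j)) = ennreal ?s" "0 \<le> ?s"
    using g by (auto intro!: sum_nonneg sum_ennreal)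
  show ?thesis
  proof (cases "?s = 0")
    case True
    then have "g l = 0" if "l \<in> {1..N}" for l
      using g that by (subst (asm) sum_nonneg_eq_0_iff) auto
    then show ?thesis
      by simp
  next
    case False
    have "ennreal ?s * ennreal (g l / ?s) = ennreal (g l)" if "l \<in> {1..N}" for l
      using False s(2) g[OF that] by (simp flip: ennreal_mult)
    then show ?thesis
      unfolding ancestor_law_def s(1) using False
      by (simp add: nn_integral_point_measure_finite sum_distrib_left flip: mult.assoc)
  qed
qed

text \<open>
  The common law of the pairs (ancestor, position) of the particles \<open>3, ..., N\<close>, which are not
  imposed.
\<close>

definition offspring_law ::
  "nat \<Rightarrow> 'a measure \<Rightarrow> ('a \<Rightarrow> real) \<Rightarrow> ('a \<Rightarrow> 'a measure) \<Rightarrow> (nat \<Rightarrow> 'a) \<Rightarrow> (nat \<times> 'a) measure" where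
  "offspring_law N S g K z =
     ancestor_law N (\<lambda>l. g (z l)) \<bind> (\<lambda>l. distr (K (z l)) (count_space {1..N} \<Otimes>\<^sub>M S) (Pair l))"

text \<open>
  Joint measurability in the old particles and the ancestor index reduces to fixed indices, because
  the index set is countable.
\<close>

lemma measurable_particle_transition:
  assumes K: "K \<in> S \<rightarrow>\<^sub>M prob_algebra S"
  shows "(\<lambda>(z, l :: nat). distr (K (z l)) (count_space {1..N} \<Otimes>\<^sub>M S) (Pair l))
    \<in> (\<Pi>\<^sub>M i\<in>{1..N}. S) \<Otimes>\<^sub>M count_space {1..N} \<rightarrow>\<^sub>M prob_algebra (count_space {1..N} \<Otimes>\<^sub>M S)"
proof -
  let ?R = "count_space {1..N} \<Otimes>\<^sub>M S"
  have "(\<lambda>p :: nat \<times> (nat \<Rightarrow> 'a). distr (K (snd p (fst p))) ?R (Pair (fst p)))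
      \<in> count_space {1..N} \<Otimes>\<^sub>M (\<Pi>\<^sub>M i\<in>{1..N}. S) \<rightarrow>\<^sub>M prob_algebra ?R"
  proof (rule measurable_pair_measure_countable1)
    fix l :: nat assume l: "l \<in> {1..N}"
    have "(\<lambda>z. K (z l)) \<in> (\<Pi>\<^sub>M i\<in>{1..N}. S) \<rightarrow>\<^sub>M prob_algebra S"
      by (rule measurable_component_compose[OF l K])
    moreover have "(\<lambda>(z, z'). (l, z')) \<in> (\<Pi>\<^sub>M i\<in>{1..N}. S) \<Otimes>\<^sub>M S \<rightarrow>\<^sub>M ?R"
      using l by simp
    ultimately show "(\<lambda>z. distr (K (snd (l, z) (fst (l, z)))) ?R (Pair (fst (l, z))))
        \<in> (\<Pi>\<^sub>M i\<in>{1..N}. S) \<rightarrow>\<^sub>M prob_algebra ?R"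
      unfolding fst_conv snd_conv by (rule measurable_distr_prob_space2)
  qed auto
  from measurable_pair_swap[OF this] show ?thesis
    by (simp only: fst_conv snd_conv)
qed

lemma measurable_offspring_law:
  assumes "1 \<le> N" "g \<in> borel_measurable S" "\<And>z. z \<in> space S \<Longrightarrow> 0 \<le> g z"
    and "K \<in> S \<rightarrow>\<^sub>M prob_algebra S"
  shows "offspring_law N S g K \<in> (\<Pi>\<^sub>M i\<in>{1..N}. S) \<rightarrow>\<^sub>M prob_algebra (count_space {1..N} \<Otimes>\<^sub>M S)"
  unfolding offspring_law_def[abs_def]
proof (rule measurable_bind_prob_space2[where N = "count_space {1..N}"
      and g = "\<lambda>z l. distr (K (z l)) (count_space {1..N} \<Otimes>\<^sub>M S) (Pair l)"])
  show "(\<lambda>z. ancestor_law N (\<lambda>l. g (z l))) \<in> (\<Pi>\<^sub>M i\<in>{1..N}. S) \<rightarrow>\<^sub>M prob_algebra (count_space {1..N})"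
    by (rule measurable_ancestor_law[where g = g and S = S]) (fact assms)+
qed (rule measurable_particle_transition[OF assms(4)])

lemma nn_integral_offspring_law:
  assumes "1 \<le> N" "g \<in> borel_measurable S" "\<And>z. z \<in> space S \<Longrightarrow> 0 \<le> g z"
    and K: "K \<in> S \<rightarrow>\<^sub>M prob_algebra S" and h[measurable]: "h \<in> borel_measurable S"
    and z: "z \<in> space (\<Pi>\<^sub>M i\<in>{1..N}. S)"
  shows "(\<integral>\<^sup>+v. h (snd v) \<partial>offspring_law N S g K z) =
    (\<integral>\<^sup>+l. (\<integral>\<^sup>+z'. h z' \<partial>K (z l)) \<partial>ancestor_law N (\<lambda>l. g (z l)))"
proof -
  have kernel: "(\<lambda>l. distr (K (z l)) (count_space {1..N} \<Otimes>\<^sub>M S) (Pair l))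
      \<in> ancestor_law N (\<lambda>l. g (z l)) \<rightarrow>\<^sub>M subprob_algebra (count_space {1..N} \<Otimes>\<^sub>M S)"
    using measurable_Pair2[OF measurable_prob_algebraD[OF measurable_particle_transition[OF K]] z]
    unfolding prod.case by (subst measurable_cong_sets[OF _ refl, of _ "count_space {1..N}"]) simp_all
  have "(\<integral>\<^sup>+v. h (snd v) \<partial>offspring_law N S g K z) =
      (\<integral>\<^sup>+l. (\<integral>\<^sup>+v. h (snd v) \<partial>distr (K (z l)) (count_space {1..N} \<Otimes>\<^sub>M S) (Pair l))
        \<partial>ancestor_law N (\<lambda>l. g (z l)))"
    unfolding offspring_law_def by (rule nn_integral_bind[OF _ kernel]) measurable
  also have "\<dots> = (\<integral>\<^sup>+l. (\<integral>\<^sup>+z'. h z' \<partial>K (z l)) \<partial>ancestor_law N (\<lambda>l. g (z l)))"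
  proof (rule nn_integral_cong)
    fix l assume "l \<in> space (ancestor_law N (\<lambda>l. g (z l)))"
    then have l: "l \<in> {1..N}" by simp
    then have sets_K: "sets (K (z l)) = sets S"
      using z measurable_space[OF K, of "z l"] by (auto simp: space_PiM PiE_iff space_prob_algebra)
    have "Pair l \<in> S \<rightarrow>\<^sub>M count_space {1..N} \<Otimes>\<^sub>M S"
      by (rule measurable_Pair1') (simp only: space_count_space l)
    then have Pair_l: "Pair l \<in> K (z l) \<rightarrow>\<^sub>M count_space {1..N} \<Otimes>\<^sub>M S"
      by (simp only: measurable_cong_sets[OF sets_K refl])
    show "(\<integral>\<^sup>+v. h (snd v) \<partial>distr (K (z l)) (count_space {1..N} \<Otimes>\<^sub>M S) (Pair l)) = (\<integral>\<^sup>+z'. h z' \<partial>K (z l))"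
      by (subst nn_integral_distr[OF Pair_l]) simp_all
  qed
  finally show ?thesis .
qed

lemma c2smc_step_eq_PiM:
  "c2smc_step N S g K a b z =
    (\<Pi>\<^sub>M i\<in>{1..N}. if i = 1 then return (count_space {1..N} \<Otimes>\<^sub>M S) (1, a)
      else if i = 2 then return (count_space {1..N} \<Otimes>\<^sub>M S) (2, b) else offspring_law N S g K z)"
  unfolding c2smc_step_def offspring_law_def ..

text \<open>
  The integral of a bind unfolds only for a measurable kernel, so the law of one step has to be a
  measurable function of the current particles.
\<close>

lemma measurable_c2smc_step:
  assumes "2 \<le> N" "g \<in> borel_measurable S" "\<And>z. z \<in> space S \<Longrightarrow> 0 \<le> g z"
    and K: "K \<in> S \<rightarrow>\<^sub>M prob_algebra S" and ab: "a \<in> space S" "b \<in> space S"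
  shows "c2smc_step N S g K a b
    \<in> (\<Pi>\<^sub>M i\<in>{1..N}. S) \<rightarrow>\<^sub>M prob_algebra (\<Pi>\<^sub>M i\<in>{1..N}. count_space {1..N} \<Otimes>\<^sub>M S)"
  unfolding c2smc_step_eq_PiM[abs_def]
proof (rule measurable_PiM_kernel)
  let ?R = "count_space {1..N} \<Otimes>\<^sub>M S"
  fix i :: nat
  have "return ?R (1, a) \<in> space (prob_algebra ?R)" "return ?R (2, b) \<in> space (prob_algebra ?R)"
    using ab \<open>2 \<le> N\<close> by (simp_all add: space_prob_algebra prob_space_return space_pair_measure)
  moreover have "offspring_law N S g K \<in> (\<Pi>\<^sub>M i\<in>{1..N}. S) \<rightarrow>\<^sub>M prob_algebra ?R"
    using assms by (intro measurable_offspring_law) auto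
  ultimately show "(\<lambda>z. if i = 1 then return ?R (1, a)
      else if i = 2 then return ?R (2, b) else offspring_law N S g K z)
      \<in> (\<Pi>\<^sub>M i\<in>{1..N}. S) \<rightarrow>\<^sub>M prob_algebra ?R"
    by (cases "i = 1"; cases "i = 2") (simp_all only: if_True if_False measurable_const simp_thms)
qed simp

text \<open>
  By linearity only the marginals matter: the first two particles are deterministic, and the other
  \<open>N - 2\<close> have the same law.
\<close>

lemma nn_integral_c2smc_step:
  assumes N: "2 \<le> N" and g: "g \<in> borel_measurable S" "\<And>z. z \<in> space S \<Longrightarrow> 0 \<le> g z"
    and K: "K \<in> S \<rightarrow>\<^sub>M prob_algebra S" and ab: "a \<in> space S" "b \<in> space S"
    and h[measurable]: "h \<in> borel_measurable S" and z: "z \<in> space (\<Pi>\<^sub>M i\<in>{1..N}. S)"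
  shows "(\<integral>\<^sup>+u. (\<Sum>j\<in>{1..N}. h (snd (u j))) \<partial>c2smc_step N S g K a b z) =
    h a + h b + of_nat (N - 2) * (\<integral>\<^sup>+l. (\<integral>\<^sup>+z'. h z' \<partial>K (z l)) \<partial>ancestor_law N (\<lambda>l. g (z l)))"
proof -
  let ?R = "count_space {1..N} \<Otimes>\<^sub>M S"
  define C where "C i = (if i = 1 then return ?R (1, a) else if i = 2 then return ?R (2, b)
      else offspring_law N S g K z)" for i :: nat
  have "offspring_law N S g K z \<in> space (prob_algebra ?R)"
    using N g K z by (intro measurable_space[OF measurable_offspring_law]) auto
  moreover have "return ?R (1, a) \<in> space (prob_algebra ?R)" "return ?R (2, b) \<in> space (prob_algebra ?R)"
    using ab N by (simp_all add: space_prob_algebra prob_space_return space_pair_measure)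
  ultimately have "C i \<in> space (prob_algebra ?R)" for i
    by (simp only: C_def split: if_split) blast
  then have C: "prob_space (C i)" "sets (C i) = sets ?R" for i
    by (simp_all only: space_prob_algebra mem_Collect_eq)
  have snd_h: "(\<lambda>v. h (snd v)) \<in> borel_measurable (C i)" for i
    by (subst measurable_cong_sets[OF C(2) refl]) measurable
  have "(\<integral>\<^sup>+u. (\<Sum>j\<in>{1..N}. h (snd (u j))) \<partial>(\<Pi>\<^sub>M i\<in>{1..N}. C i)) =
      (\<Sum>j\<in>{1..N}. \<integral>\<^sup>+u. h (snd (u j)) \<partial>(\<Pi>\<^sub>M i\<in>{1..N}. C i))"
  proof (rule nn_integral_sum)
    fix j assume "j \<in> {1..N}"
    then show "(\<lambda>u. h (snd (u j))) \<in> borel_measurable (\<Pi>\<^sub>M i\<in>{1..N}. C i)"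
      by (rule measurable_component_compose[where h = "\<lambda>v. h (snd v)"]) (rule snd_h)
  qed
  also have "\<dots> = (\<Sum>j\<in>{1..N}. \<integral>\<^sup>+v. h (snd v) \<partial>C j)"
    by (rule sum.cong[OF refl], rule nn_integral_PiM_component[where M = C and f = "\<lambda>v. h (snd v)"])
       (simp_all only: C(1) snd_h)
  also have "\<dots> = (\<integral>\<^sup>+v. h (snd v) \<partial>C 1) + (\<integral>\<^sup>+v. h (snd v) \<partial>C 2) +
      of_nat (N - 2) * (\<integral>\<^sup>+v. h (snd v) \<partial>offspring_law N S g K z)"
    by (rule sum_first_two_and_others[OF N]) (simp add: C_def)
  also have "(\<integral>\<^sup>+v. h (snd v) \<partial>C 1) = h a"
    unfolding C_def using ab N by (simp add: nn_integral_return space_pair_measure)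
  also have "(\<integral>\<^sup>+v. h (snd v) \<partial>C 2) = h b"
    unfolding C_def using ab N by (simp add: nn_integral_return space_pair_measure)
  also have "(\<integral>\<^sup>+v. h (snd v) \<partial>offspring_law N S g K z) =
      (\<integral>\<^sup>+l. (\<integral>\<^sup>+z'. h z' \<partial>K (z l)) \<partial>ancestor_law N (\<lambda>l. g (z l)))"
    by (rule nn_integral_offspring_law[OF _ g(1) _ K h z]) (use N g(2) in auto)
  finally show ?thesis
    unfolding c2smc_step_eq_PiM C_def .
qed

lemma c2smc_init_in_prob_algebra:
  assumes "prob_space M1" "sets M1 = sets S" "a \<in> space S" "b \<in> space S"
  shows "c2smc_init N S M1 a b \<in> space (prob_algebra (\<Pi>\<^sub>M i\<in>{1..N}. S))"
proof -
  define C where "C i = (if i = 1 then return S a else if i = 2 then return S b else M1)" for i :: nat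
  have C: "prob_space (C i)" "sets (C i) = sets S" for i
    using assms by (auto simp: C_def prob_space_return)
  have "prob_space (\<Pi>\<^sub>M i\<in>{1..N}. C i)"
    by (rule prob_space_PiM) (rule C(1))
  moreover have "sets (\<Pi>\<^sub>M i\<in>{1..N}. C i) = sets (\<Pi>\<^sub>M i\<in>{1..N}. S)"
    by (rule sets_PiM_cong[OF refl]) (rule C(2))
  ultimately show ?thesis
    unfolding c2smc_init_def space_prob_algebra C_def by blast
qed

lemma nn_integral_c2smc_init:
  assumes N: "2 \<le> N" and M1: "prob_space M1" "sets M1 = sets S"
    and ab: "a \<in> space S" "b \<in> space S" and h: "h \<in> borel_measurable S"
  shows "(\<integral>\<^sup>+z. (\<Sum>j\<in>{1..N}. h (z j)) \<partial>c2smc_init N S M1 a b) =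
    h a + h b + of_nat (N - 2) * (\<integral>\<^sup>+z. h z \<partial>M1)"
proof -
  define C where "C i = (if i = 1 then return S a else if i = 2 then return S b else M1)" for i :: nat
  have C: "prob_space (C i)" "sets (C i) = sets S" for i
    using M1 ab by (auto simp: C_def prob_space_return)
  have h_C: "h \<in> borel_measurable (C i)" for i
    by (subst measurable_cong_sets[OF C(2) refl]) (rule h)
  have "(\<integral>\<^sup>+z. (\<Sum>j\<in>{1..N}. h (z j)) \<partial>(\<Pi>\<^sub>M i\<in>{1..N}. C i)) =
      (\<Sum>j\<in>{1..N}. \<integral>\<^sup>+z. h (z j) \<partial>(\<Pi>\<^sub>M i\<in>{1..N}. C i))"
  proof (rule nn_integral_sum)
    fix j assume "j \<in> {1..N}"
    then show "(\<lambda>z. h (z j)) \<in> borel_measurable (\<Pi>\<^sub>M i\<in>{1..N}. C i)"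
      by (rule measurable_component_compose) (rule h_C)
  qed
  also have "\<dots> = (\<Sum>j\<in>{1..N}. \<integral>\<^sup>+v. h v \<partial>C j)"
    by (rule sum.cong[OF refl], rule nn_integral_PiM_component[where M = C and f = h])
       (simp_all only: C(1) h_C)
  also have "\<dots> = (\<integral>\<^sup>+v. h v \<partial>C 1) + (\<integral>\<^sup>+v. h v \<partial>C 2) + of_nat (N - 2) * (\<integral>\<^sup>+v. h v \<partial>M1)"
    by (rule sum_first_two_and_others[OF N]) (simp add: C_def)
  also have "(\<integral>\<^sup>+v. h v \<partial>C 1) = h a"
    unfolding C_def using ab h by (simp add: nn_integral_return)
  also have "(\<integral>\<^sup>+v. h v \<partial>C 2) = h b"
    unfolding C_def using ab h by (simp add: nn_integral_return)
  finally show ?thesis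
    unfolding c2smc_init_def C_def .
qed

section \<open>Sums over increasing sequences of indices\<close>

lemma finite_index_chains: "finite (index_chains T s)"
proof (rule finite_subset)
  show "index_chains T s \<subseteq> {1..s} \<rightarrow>\<^sub>E {1..T + 1}"
    by (auto simp: index_chains_def)
qed (simp add: finite_PiE)

lemma index_chains_one: "index_chains T 1 = {\<lambda>k\<in>{1}. T + 1}"
proof (intro equalityI subsetI)
  fix i assume "i \<in> index_chains T 1"
  then have "i \<in> extensional {1}" "i 1 = T + 1"
    by (auto simp: index_chains_def PiE_iff)
  then show "i \<in> {\<lambda>k\<in>{1}. T + 1}"
    by (auto simp: fun_eq_iff extensional_def)
qed (auto simp: index_chains_def strict_mono_on_def)

text \<open>
  The inner sum of the formula, with an arbitrary two-point function \<open>B\<close> as factor and the first index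
  fixed to \<open>q\<close>, so that the recursion over the first jump can be stated.
\<close>

definition chain_sum :: "nat \<Rightarrow> (nat \<Rightarrow> nat \<Rightarrow> 'b :: comm_semiring_1) \<Rightarrow> nat \<Rightarrow> nat \<Rightarrow> 'b" where
  "chain_sum T B s q =
    (\<Sum>i\<in>{i \<in> index_chains T s. i 1 = q}. \<Prod>m\<in>{1..<s}. B (i m) (i (m + 1)))"

lemma chain_sum_one: "chain_sum T B 1 q = (if q = T + 1 then 1 else 0)"
proof -
  have "{i \<in> index_chains T 1. i 1 = q} = (if q = T + 1 then index_chains T 1 else {})"
    by (auto simp: index_chains_def)
  then show ?thesis
    unfolding chain_sum_def using index_chains_one[of T] by simp
qed

lemma tail_in_index_chains:
  assumes "1 \<le> s" and i: "i \<in> index_chains T (Suc s)"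
  shows "(\<lambda>m\<in>{1..s}. i (Suc m)) \<in> index_chains T s" and "i 1 < i 2" and "i 2 \<le> T + 1"
proof -
  have mono: "strict_mono_on {1..Suc s} i" and range: "i \<in> {1..Suc s} \<rightarrow>\<^sub>E {1..T + 1}"
    and last: "i (Suc s) = T + 1"
    using i by (auto simp: index_chains_def)
  show "(\<lambda>m\<in>{1..s}. i (Suc m)) \<in> index_chains T s"
    using mono range last assms(1) by (auto simp: index_chains_def strict_mono_on_def PiE_iff)
  show "i 1 < i 2"
    using assms(1) by (intro strict_mono_onD[OF mono]) auto
  show "i 2 \<le> T + 1"
    using range assms(1) by (auto simp: PiE_iff)
qed

lemma cons_in_index_chains:
  assumes "1 \<le> s" and i: "i \<in> index_chains T s" and q: "1 \<le> q" "q < i 1"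
  shows "(\<lambda>m\<in>{1..Suc s}. if m = 1 then q else i (m - 1)) \<in> index_chains T (Suc s)"
proof -
  have mono: "strict_mono_on {1..s} i" and range: "i \<in> {1..s} \<rightarrow>\<^sub>E {1..T + 1}"
    and last: "i s = T + 1"
    using i by (auto simp: index_chains_def)
  have first: "i 1 \<le> i m" if "m \<in> {1..s}" for m
    using that strict_mono_onD[OF mono, of 1 m] by (cases "m = 1") auto
  have "i 1 \<le> T + 1"
    using range assms(1) by (auto simp: PiE_iff)
  then have into: "(if m = 1 then q else i (m - 1)) \<in> {1..T + 1}" if "m \<in> {1..Suc s}" for m
    using that q PiE_mem[OF range, of "m - 1"] by (cases "m = 1"; cases m) auto
  have "strict_mono_on {1..Suc s} (\<lambda>m\<in>{1..Suc s}. if m = 1 then q else i (m - 1))"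
  proof (rule strict_mono_onI)
    fix m m' assume m: "m \<in> {1..Suc s}" "m' \<in> {1..Suc s}" "m < m'"
    show "(\<lambda>m\<in>{1..Suc s}. if m = 1 then q else i (m - 1)) m
        < (\<lambda>m\<in>{1..Suc s}. if m = 1 then q else i (m - 1)) m'"
    proof (cases "m = 1")
      case True
      then show ?thesis
        using m q first[of "m' - 1"] by (cases m') auto
    next
      case False
      then show ?thesis
        using m strict_mono_onD[OF mono, of "m - 1" "m' - 1"] by auto
    qed
  qed
  then show ?thesis
    using into last assms(1) unfolding index_chains_def by auto
qed

text \<open>
  A sequence of length \<open>s + 1\<close> from \<open>q\<close> is its second entry \<open>r > q\<close> together with the sequence of length \<open>s\<close>
  that starts at \<open>r\<close>.
\<close>

lemma chain_sum_Suc: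
  assumes s: "1 \<le> s" and q: "1 \<le> q"
  shows "chain_sum T B (Suc s) q = (\<Sum>r\<in>{q<..T + 1}. B q r * chain_sum T B s r)"
proof -
  let ?X = "{i \<in> index_chains T (Suc s). i 1 = q}"
  let ?Y = "SIGMA r:{q<..T + 1}. {i \<in> index_chains T s. i 1 = r}"
  let ?tail = "\<lambda>i. \<lambda>m\<in>{1..s}. i (Suc m)"
  let ?cons = "\<lambda>i. \<lambda>m\<in>{1..Suc s}. if m = 1 then q else i (m - 1)"
  have "(\<Sum>i\<in>?X. \<Prod>m\<in>{1..<Suc s}. B (i m) (i (m + 1))) =
      (\<Sum>(r, i)\<in>?Y. B q r * (\<Prod>m\<in>{1..<s}. B (i m) (i (m + 1))))"
  proof (rule sum.reindex_bij_witness[where i = "\<lambda>(r, i). ?cons i" and j = "\<lambda>i. (i 2, ?tail i)"])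
    fix i assume i: "i \<in> ?X"
    then have ext: "i \<in> extensional {1..Suc s}"
      by (auto simp: index_chains_def PiE_iff)
    show "(case (i 2, ?tail i) of (r, i) \<Rightarrow> ?cons i) = i"
      using i ext s by (auto simp: fun_eq_iff extensional_def)
    show "(i 2, ?tail i) \<in> ?Y"
      using i s tail_in_index_chains[OF s, of i T] by (auto simp: numeral_2_eq_2)
    have "(\<Prod>m\<in>{1..<Suc s}. B (i m) (i (m + 1))) =
        B (i 1) (i 2) * (\<Prod>m\<in>{Suc 1..<Suc s}. B (i m) (i (m + 1)))"
      using s by (subst prod.atLeast_Suc_lessThan) (auto simp: numeral_2_eq_2)
    also have "(\<Prod>m\<in>{Suc 1..<Suc s}. B (i m) (i (m + 1))) =
        (\<Prod>m\<in>{1..<s}. B (?tail i m) (?tail i (m + 1)))"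
      unfolding prod.shift_bounds_Suc_ivl by (rule prod.cong) auto
    finally show "(case (i 2, ?tail i) of (r, i) \<Rightarrow>
        B q r * (\<Prod>m\<in>{1..<s}. B (i m) (i (m + 1)))) = (\<Prod>m\<in>{1..<Suc s}. B (i m) (i (m + 1)))"
      using i by simp
  next
    fix p assume "p \<in> ?Y"
    then obtain r i where p: "p = (r, i)" and r: "q < r" "r \<le> T + 1" "i 1 = r"
      and i: "i \<in> index_chains T s"
      by auto
    then have ext: "i \<in> extensional {1..s}"
      by (auto simp: index_chains_def PiE_iff)
    show "(case p of (r, i) \<Rightarrow> ?cons i) \<in> ?X"
      using cons_in_index_chains[OF s i q] r by (simp add: p)
    show "(\<lambda>i. (i 2, ?tail i)) (case p of (r, i) \<Rightarrow> ?cons i) = p"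
      using s r ext by (auto simp: p fun_eq_iff extensional_def)
  qed
  also have "\<dots> = (\<Sum>r\<in>{q<..T + 1}. \<Sum>i\<in>{i \<in> index_chains T s. i 1 = r}.
      B q r * (\<Prod>m\<in>{1..<s}. B (i m) (i (m + 1))))"
    using finite_index_chains[of T s] by (subst sum.Sigma) auto
  finally show ?thesis
    by (simp add: chain_sum_def sum_distrib_left)
qed

text \<open>
  There are only \<open>T + 2 - q\<close> integers from \<open>q\<close> to \<open>T + 1\<close>.  This makes the truncated subtractions in the
  exponents below harmless: they are wrong only where the accompanying sum is empty.
\<close>

lemma chain_sum_eq_0:
  assumes "1 \<le> s" "1 \<le> q" "T + 2 < s + q"
  shows "chain_sum T B s q = 0"
  using assms
proof (induction s arbitrary: q rule: nat_induct_at_least)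
  case base
  then show ?case
    using chain_sum_one[of T B q] by simp
next
  case (Suc s)
  have "chain_sum T B s r = 0" if "r \<in> {q<..T + 1}" for r
    using that Suc by auto
  then show ?case
    using Suc by (simp add: chain_sum_Suc)
qed

text \<open>
  The sum over all sequences from \<open>q\<close> to \<open>T + 1\<close>, of any length, in which every integer strictly between
  \<open>q\<close> and \<open>T + 1\<close> that is skipped carries the factor \<open>c\<close>.
\<close>

definition spaced_chain_sum ::
  "nat \<Rightarrow> (nat \<Rightarrow> nat \<Rightarrow> 'b :: comm_semiring_1) \<Rightarrow> 'b \<Rightarrow> nat \<Rightarrow> 'b" where
  "spaced_chain_sum T B c q = (\<Sum>s\<in>{1..T + 1}. c ^ (T + 2 - q - s) * chain_sum T B s q)"

lemma spaced_chain_sum_last: "spaced_chain_sum T B c (T + 1) = 1"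
proof -
  have "spaced_chain_sum T B c (T + 1) = (\<Sum>s\<in>{1..T + 1}. if s = 1 then 1 else 0)"
    unfolding spaced_chain_sum_def
  proof (rule sum.cong[OF refl])
    fix s assume "s \<in> {1..T + 1}"
    then show "c ^ (T + 2 - (T + 1) - s) * chain_sum T B s (T + 1) = (if s = 1 then 1 else 0)"
      using chain_sum_one[of T B "T + 1"] chain_sum_eq_0[of s "T + 1" T B] by (cases "s = 1") auto
  qed
  then show ?thesis
    by simp
qed

text \<open>
  The renewal equation.  A first jump from \<open>q\<close> to \<open>r\<close> skips \<open>r - q - 1\<close> integers.
\<close>

lemma spaced_chain_sum_rec:
  assumes q: "1 \<le> q" "q \<le> T"
  shows "spaced_chain_sum T B c q =
    (\<Sum>r\<in>{q<..T + 1}. B q r * c ^ (r - q - 1) * spaced_chain_sum T B c r)"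
proof -
  have shift: "c ^ (T + 2 - q - Suc s) * (B q r * chain_sum T B s r) =
      B q r * c ^ (r - q - 1) * (c ^ (T + 2 - r - s) * chain_sum T B s r)"
    if "s \<in> {1..T}" "r \<in> {q<..T + 1}" for r s
  proof (cases "T + 2 < s + r")
    case True
    then show ?thesis
      using that chain_sum_eq_0[of s r T B] by auto
  next
    case False
    then have "T + 2 - q - Suc s = (r - q - 1) + (T + 2 - r - s)"
      using that by auto
    then have "c ^ (T + 2 - q - Suc s) = c ^ (r - q - 1) * c ^ (T + 2 - r - s)"
      by (simp only: power_add)
    then show ?thesis
      by (simp only: ac_simps)
  qed
  have top: "chain_sum T B (T + 1) r = 0" if "r \<in> {q<..T + 1}" for r
    using that q by (intro chain_sum_eq_0) auto
  have "spaced_chain_sum T B c q =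
      c ^ (T + 2 - q - 1) * chain_sum T B 1 q +
      (\<Sum>s\<in>{Suc 1..Suc T}. c ^ (T + 2 - q - s) * chain_sum T B s q)"
    unfolding spaced_chain_sum_def by (subst sum.atLeast_Suc_atMost) auto
  also have "\<dots> = (\<Sum>s\<in>{1..T}. c ^ (T + 2 - q - Suc s) * chain_sum T B (Suc s) q)"
    using q unfolding sum.shift_bounds_cl_Suc_ivl chain_sum_one by simp
  also have "\<dots> = (\<Sum>s\<in>{1..T}. \<Sum>r\<in>{q<..T + 1}.
      c ^ (T + 2 - q - Suc s) * (B q r * chain_sum T B s r))"
    using q by (intro sum.cong refl) (simp add: chain_sum_Suc sum_distrib_left)
  also have "\<dots> = (\<Sum>s\<in>{1..T}. \<Sum>r\<in>{q<..T + 1}.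
      B q r * c ^ (r - q - 1) * (c ^ (T + 2 - r - s) * chain_sum T B s r))"
    by (intro sum.cong refl shift)
  also have "\<dots> = (\<Sum>r\<in>{q<..T + 1}. B q r * c ^ (r - q - 1) *
      (\<Sum>s\<in>{1..T}. c ^ (T + 2 - r - s) * chain_sum T B s r))"
    by (subst sum.swap) (simp only: sum_distrib_left)
  also have "\<dots> = (\<Sum>r\<in>{q<..T + 1}. B q r * c ^ (r - q - 1) * spaced_chain_sum T B c r)"
    \<comment> \<open>Length \<open>T + 1\<close> contributes nothing to the right-hand side, since \<open>r > 1\<close>.\<close>
    unfolding spaced_chain_sum_def using top by (intro sum.cong refl) simp
  finally show ?thesis .
qed

text \<open>
  Grouping the sequences by their first index \<open>q\<close>; before \<open>q\<close>, the \<open>q - 1\<close> positive integers are skipped.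
\<close>

lemma sum_over_index_chains:
  fixes a :: "nat \<Rightarrow> 'b :: comm_semiring_1"
  shows "(\<Sum>s\<in>{1..T + 1}. c ^ (T + 1 - s) *
      (\<Sum>i\<in>index_chains T s. a (i 1) * (\<Prod>m\<in>{1..<s}. B (i m) (i (m + 1))))) =
    (\<Sum>q\<in>{1..T + 1}. a q * c ^ (q - 1) * spaced_chain_sum T B c q)"
proof -
  have shift: "c ^ (T + 1 - s) * (a q * chain_sum T B s q) =
      a q * c ^ (q - 1) * (c ^ (T + 2 - q - s) * chain_sum T B s q)"
    if "s \<in> {1..T + 1}" "q \<in> {1..T + 1}" for s q
  proof (cases "T + 2 < s + q")
    case True
    then show ?thesis
      using that chain_sum_eq_0[of s q T B] by auto
  next
    case False
    then have "T + 1 - s = (q - 1) + (T + 2 - q - s)"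
      using that by auto
    then have "c ^ (T + 1 - s) = c ^ (q - 1) * c ^ (T + 2 - q - s)"
      by (simp only: power_add)
    then show ?thesis
      by (simp only: ac_simps)
  qed
  have by_first: "(\<Sum>i\<in>index_chains T s. a (i 1) * (\<Prod>m\<in>{1..<s}. B (i m) (i (m + 1)))) =
      (\<Sum>q\<in>{1..T + 1}. a q * chain_sum T B s q)" if "s \<in> {1..T + 1}" for s
  proof -
    have "(\<lambda>i. i 1) ` index_chains T s \<subseteq> {1..T + 1}"
      using that by (auto simp: index_chains_def PiE_iff)
    then have "(\<Sum>i\<in>index_chains T s. a (i 1) * (\<Prod>m\<in>{1..<s}. B (i m) (i (m + 1)))) =
        (\<Sum>q\<in>{1..T + 1}. \<Sum>i\<in>{i \<in> index_chains T s. i 1 = q}.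
          a (i 1) * (\<Prod>m\<in>{1..<s}. B (i m) (i (m + 1))))"
      by (intro sum.group[symmetric] finite_index_chains) auto
    also have "\<dots> = (\<Sum>q\<in>{1..T + 1}. a q * chain_sum T B s q)"
      unfolding chain_sum_def sum_distrib_left by (intro sum.cong refl) auto
    finally show ?thesis .
  qed
  have "(\<Sum>s\<in>{1..T + 1}. c ^ (T + 1 - s) *
      (\<Sum>i\<in>index_chains T s. a (i 1) * (\<Prod>m\<in>{1..<s}. B (i m) (i (m + 1))))) =
    (\<Sum>s\<in>{1..T + 1}. \<Sum>q\<in>{1..T + 1}. c ^ (T + 1 - s) * (a q * chain_sum T B s q))"
    by (intro sum.cong refl) (simp only: by_first sum_distrib_left)
  also have "\<dots> = (\<Sum>s\<in>{1..T + 1}. \<Sum>q\<in>{1..T + 1}.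
      a q * c ^ (q - 1) * (c ^ (T + 2 - q - s) * chain_sum T B s q))"
    by (intro sum.cong refl shift)
  also have "\<dots> = (\<Sum>q\<in>{1..T + 1}. a q * c ^ (q - 1) * spaced_chain_sum T B c q)"
    unfolding spaced_chain_sum_def by (subst sum.swap) (simp only: sum_distrib_left)
  finally show ?thesis .
qed

section \<open>The unnormalised Feynman--Kac semigroup\<close>

locale feynman_kac =
  fixes S M1 :: "'a measure" and M :: "nat \<Rightarrow> 'a \<Rightarrow> 'a measure" and G :: "nat \<Rightarrow> 'a \<Rightarrow> real" and T :: nat
  assumes M1_prob: "prob_space M1" and sets_M1: "sets M1 = sets S"
    and M_kernel: "\<And>t. t \<in> {2..T} \<Longrightarrow> M t \<in> S \<rightarrow>\<^sub>M prob_algebra S"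
    and G_measurable: "\<And>t. t \<in> {1..T} \<Longrightarrow> G t \<in> borel_measurable S"
    and G_nonneg: "\<And>t z. t \<in> {1..T} \<Longrightarrow> z \<in> space S \<Longrightarrow> 0 \<le> G t z"
begin

lemma space_M1: "space M1 = space S"
  using sets_M1 by (rule sets_eq_imp_space_eq)

lemma M1_in_prob_algebra: "M1 \<in> space (prob_algebra S)"
  using M1_prob sets_M1 by (simp add: space_prob_algebra)

lemma M_prob:
  assumes "t \<in> {2..T}" "z \<in> space S"
  shows "prob_space (M t z)" "sets (M t z) = sets S" "space (M t z) = space S"
  using measurable_space[OF M_kernel[OF assms(1)] assms(2)]
  by (auto simp: space_prob_algebra dest: sets_eq_imp_space_eq)

lemma measurable_M_integral:
  assumes "t \<in> {2..T}" and "h \<in> borel_measurable S"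
  shows "(\<lambda>z. \<integral>\<^sup>+z'. h z' \<partial>M t z) \<in> borel_measurable S"
  by (rule measurable_compose[OF measurable_prob_algebraD[OF M_kernel[OF assms(1)]]
        nn_integral_measurable_subprob_algebra[OF assms(2)]])

lemma measurable_ennreal_G: "t \<in> {1..T} \<Longrightarrow> (\<lambda>z. ennreal (G t z)) \<in> borel_measurable S"
  by (rule measurable_compose[OF G_measurable measurable_ennreal])

text \<open>
  \<open>propagate p n\<close> is the unnormalised Feynman--Kac semigroup: it maps \<open>h\<close> to
  \<open>z \<mapsto> E[G\<^sub>p(Z\<^sub>p) ... G\<^sub>p\<^sub>+\<^sub>n\<^sub>-\<^sub>1(Z\<^sub>p\<^sub>+\<^sub>n\<^sub>-\<^sub>1) h(Z\<^sub>p\<^sub>+\<^sub>n) | Z\<^sub>p = z]\<close>.  The recursion peels off the last transition because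
  \<open>chain_law\<close> is built by appending states at the end.
\<close>

primrec propagate :: "nat \<Rightarrow> nat \<Rightarrow> ('a \<Rightarrow> ennreal) \<Rightarrow> 'a \<Rightarrow> ennreal" where
  "propagate p 0 h = h"
| "propagate p (Suc n) h =
    propagate p n (\<lambda>z. ennreal (G (p + n) z) * (\<integral>\<^sup>+z'. h z' \<partial>M (Suc (p + n)) z))"

text \<open>
  The same semigroup, peeled from the front.  The backward recursion for the particle system needs this
  form.
\<close>

lemma propagate_first_step:
  "propagate p (Suc n) h =
    (\<lambda>z. ennreal (G p z) * (\<integral>\<^sup>+z'. propagate (Suc p) n h z' \<partial>M (Suc p) z))"
proof (induction n arbitrary: h)
  case (Suc n)
  show ?case
    by (subst propagate.simps, subst Suc) simp
qed simp

lemma measurable_weighted_M_integral: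
  assumes "t \<in> {1..T}" "Suc t \<in> {2..T}" and h: "h \<in> borel_measurable S"
  shows "(\<lambda>z. ennreal (G t z) * (\<integral>\<^sup>+z'. h z' \<partial>M (Suc t) z)) \<in> borel_measurable S"
  using G_measurable[OF assms(1)] measurable_M_integral[OF assms(2) h] by measurable

lemma measurable_propagate:
  assumes "1 \<le> p" "p + n \<le> T" and "h \<in> borel_measurable S"
  shows "propagate p n h \<in> borel_measurable S"
  using assms(2,3)
proof (induction n arbitrary: h)
  case (Suc n)
  then show ?case
    using assms(1) by (simp add: measurable_weighted_M_integral)
qed simp

lemma chain_law_kernel:
  assumes "1 \<le> p" "p + Suc n \<le> T"
  shows "(\<lambda>w. distr (M (p + Suc n) (w (p + n))) (\<Pi>\<^sub>M k\<in>{p..p + Suc n}. S) (\<lambda>z. w(p + Suc n := z)))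
    \<in> (\<Pi>\<^sub>M k\<in>{p..p + n}. S) \<rightarrow>\<^sub>M prob_algebra (\<Pi>\<^sub>M k\<in>{p..p + Suc n}. S)"
proof (rule measurable_distr_prob_space2[where M = S])
  show "(\<lambda>w. M (p + Suc n) (w (p + n))) \<in> (\<Pi>\<^sub>M k\<in>{p..p + n}. S) \<rightarrow>\<^sub>M prob_algebra S"
    using assms by (intro measurable_component_compose M_kernel) auto
  show "(\<lambda>(w, z). w(p + Suc n := z))
      \<in> (\<Pi>\<^sub>M k\<in>{p..p + n}. S) \<Otimes>\<^sub>M S \<rightarrow>\<^sub>M (\<Pi>\<^sub>M k\<in>{p..p + Suc n}. S)"
    unfolding case_prod_beta
    by (rule measurable_fun_upd[OF _ measurable_fst measurable_snd]) auto
qed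

lemma chain_law_in_prob_algebra:
  assumes D: "D \<in> space (prob_algebra S)" and "1 \<le> p" "p + n \<le> T"
  shows "chain_law S M p D n \<in> space (prob_algebra (\<Pi>\<^sub>M k\<in>{p..p + n}. S))"
  using assms(3)
proof (induction n)
  case 0
  have "(\<lambda>z. \<lambda>k\<in>{p..p}. z) \<in> S \<rightarrow>\<^sub>M (\<Pi>\<^sub>M k\<in>{p..p}. S)"
    by (rule measurable_restrict) simp
  from measurable_space[OF measurable_distr_prob_space[OF this] D] show ?case
    by simp
next
  case (Suc n)
  then have "chain_law S M p D n \<in> space (prob_algebra (\<Pi>\<^sub>M k\<in>{p..p + n}. S))"
    by simp
  from prob_space_bind'[OF this chain_law_kernel] sets_bind'[OF this chain_law_kernel] show ?case
    using assms(2) Suc.prems by (simp add: space_prob_algebra)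
qed

lemma nn_integral_chain_law_0:
  assumes D: "D \<in> space (prob_algebra S)" and f: "f \<in> borel_measurable (\<Pi>\<^sub>M k\<in>{p..p}. S)"
  shows "(\<integral>\<^sup>+w. f w \<partial>chain_law S M p D 0) = (\<integral>\<^sup>+z. f (\<lambda>k\<in>{p..p}. z) \<partial>D)"
proof -
  have sets_D: "sets D = sets S"
    using D by (simp add: space_prob_algebra)
  have "(\<lambda>z. \<lambda>k\<in>{p..p}. z) \<in> S \<rightarrow>\<^sub>M (\<Pi>\<^sub>M k\<in>{p..p}. S)"
    by (rule measurable_restrict) simp
  then have "(\<lambda>z. \<lambda>k\<in>{p..p}. z) \<in> D \<rightarrow>\<^sub>M (\<Pi>\<^sub>M k\<in>{p..p}. S)"
    by (simp only: measurable_cong_sets[OF sets_D refl])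
  then show ?thesis
    unfolding chain_law.simps using f by (subst nn_integral_distr) simp_all
qed

lemma nn_integral_chain_law_Suc:
  assumes D: "D \<in> space (prob_algebra S)" and p: "1 \<le> p" "p + Suc n \<le> T"
    and f: "f \<in> borel_measurable (\<Pi>\<^sub>M k\<in>{p..p + Suc n}. S)"
  shows "(\<integral>\<^sup>+w. f w \<partial>chain_law S M p D (Suc n)) =
    (\<integral>\<^sup>+w. (\<integral>\<^sup>+z. f (w(p + Suc n := z)) \<partial>M (p + Suc n) (w (p + n))) \<partial>chain_law S M p D n)"
proof -
  have law: "sets (chain_law S M p D n) = sets (\<Pi>\<^sub>M k\<in>{p..p + n}. S)"
    using chain_law_in_prob_algebra[OF D p(1), of n] p(2) by (simp add: space_prob_algebra)
  have kernel: "(\<lambda>w. distr (M (p + Suc n) (w (p + n))) (\<Pi>\<^sub>M k\<in>{p..p + Suc n}. S) (\<lambda>z. w(p + Suc n := z)))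
      \<in> chain_law S M p D n \<rightarrow>\<^sub>M subprob_algebra (\<Pi>\<^sub>M k\<in>{p..p + Suc n}. S)"
    unfolding measurable_cong_sets[OF law refl]
    by (rule measurable_prob_algebraD[OF chain_law_kernel[OF p]])
  show ?thesis
    unfolding chain_law.simps nn_integral_bind[OF f kernel]
  proof (rule nn_integral_cong)
    fix w assume "w \<in> space (chain_law S M p D n)"
    then have w: "w \<in> space (\<Pi>\<^sub>M k\<in>{p..p + n}. S)"
      by (simp only: sets_eq_imp_space_eq[OF law])
    then have "w (p + n) \<in> space S"
      by (auto simp: space_PiM PiE_iff)
    then have sets_M: "sets (M (p + Suc n) (w (p + n))) = sets S"
      using p by (intro M_prob) auto
    have "(\<lambda>z. w(p + Suc n := z)) \<in> S \<rightarrow>\<^sub>M (\<Pi>\<^sub>M k\<in>{p..p + Suc n}. S)"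
    proof (rule measurable_fun_upd[where f = "\<lambda>_. w" and J = "{p..p + n}" and h = "\<lambda>z. z"])
      show "{p..p + Suc n} = {p..p + n} \<union> {p + Suc n}"
        by auto
      show "(\<lambda>_. w) \<in> S \<rightarrow>\<^sub>M (\<Pi>\<^sub>M k\<in>{p..p + n}. S)"
        by (rule measurable_const[OF w])
      show "(\<lambda>z. z) \<in> S \<rightarrow>\<^sub>M S"
        by (rule measurable_ident_sets[OF refl])
    qed
    then have "(\<lambda>z. w(p + Suc n := z)) \<in> M (p + Suc n) (w (p + n)) \<rightarrow>\<^sub>M (\<Pi>\<^sub>M k\<in>{p..p + Suc n}. S)"
      by (simp only: measurable_cong_sets[OF sets_M refl])
    then show "(\<integral>\<^sup>+w. f w \<partial>distr (M (p + Suc n) (w (p + n))) (\<Pi>\<^sub>M k\<in>{p..p + Suc n}. S) (\<lambda>z. w(p + Suc n := z)))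
        = (\<integral>\<^sup>+z. f (w(p + Suc n := z)) \<partial>M (p + Suc n) (w (p + n)))"
      using f by (subst nn_integral_distr) simp_all
  qed
qed

lemma measurable_potential_product:
  assumes "1 \<le> p" "q \<le> Suc T" "{p..<q} \<subseteq> I"
  shows "(\<lambda>w. \<Prod>k\<in>{p..<q}. ennreal (G k (w k))) \<in> borel_measurable (\<Pi>\<^sub>M k\<in>I. S)"
proof (rule borel_measurable_prod_ennreal)
  fix k assume k: "k \<in> {p..<q}"
  have "(\<lambda>z. ennreal (G k z)) \<in> borel_measurable S"
    using k assms by (intro measurable_ennreal_G) auto
  then show "(\<lambda>w. ennreal (G k (w k))) \<in> borel_measurable (\<Pi>\<^sub>M k\<in>I. S)"
    using k assms(3) by (intro measurable_component_compose[where h = "\<lambda>z. ennreal (G k z)"]) auto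
qed

lemma nn_integral_chain_law_propagate:
  assumes D: "D \<in> space (prob_algebra S)" and p: "1 \<le> p" "p + n \<le> T" and h: "h \<in> borel_measurable S"
  shows "(\<integral>\<^sup>+w. (\<Prod>k\<in>{p..<p + n}. ennreal (G k (w k))) * h (w (p + n)) \<partial>chain_law S M p D n) =
    (\<integral>\<^sup>+z. propagate p n h z \<partial>D)"
  using p(2) h
proof (induction n arbitrary: h)
  case 0
  have "(\<lambda>w. h (w p)) \<in> borel_measurable (\<Pi>\<^sub>M k\<in>{p..p}. S)"
    by (rule measurable_component_compose[where h = h]) (simp, rule 0)
  then show ?case
    using nn_integral_chain_law_0[OF D, of "\<lambda>w. h (w p)" p] by simp
next
  case (Suc n)
  let ?W = "\<lambda>w. \<Prod>k\<in>{p..<p + n}. ennreal (G k (w k))"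
  have "(\<lambda>w. h (w (p + Suc n))) \<in> borel_measurable (\<Pi>\<^sub>M k\<in>{p..p + Suc n}. S)"
    by (rule measurable_component_compose[where h = h]) (simp, rule Suc.prems)
  moreover have "(\<lambda>w. \<Prod>k\<in>{p..<p + Suc n}. ennreal (G k (w k))) \<in> borel_measurable (\<Pi>\<^sub>M k\<in>{p..p + Suc n}. S)"
    using p(1) Suc.prems by (intro measurable_potential_product) auto
  ultimately have f: "(\<lambda>w. (\<Prod>k\<in>{p..<p + Suc n}. ennreal (G k (w k))) * h (w (p + Suc n)))
      \<in> borel_measurable (\<Pi>\<^sub>M k\<in>{p..p + Suc n}. S)"
    by (rule borel_measurable_times_ennreal[rotated])
  have law: "sets (chain_law S M p D n) = sets (\<Pi>\<^sub>M k\<in>{p..p + n}. S)"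
    using chain_law_in_prob_algebra[OF D p(1), of n] Suc.prems(1) by (simp add: space_prob_algebra)
  have "(\<integral>\<^sup>+w. (\<Prod>k\<in>{p..<p + Suc n}. ennreal (G k (w k))) * h (w (p + Suc n)) \<partial>chain_law S M p D (Suc n)) =
      (\<integral>\<^sup>+w. (\<integral>\<^sup>+z. (\<Prod>k\<in>{p..<p + Suc n}. ennreal (G k ((w(p + Suc n := z)) k))) * h z
        \<partial>M (p + Suc n) (w (p + n))) \<partial>chain_law S M p D n)"
    unfolding nn_integral_chain_law_Suc[OF D p(1) Suc.prems(1) f] by simp
  also have "\<dots> = (\<integral>\<^sup>+w. ?W w * (ennreal (G (p + n) (w (p + n))) *
      (\<integral>\<^sup>+z. h z \<partial>M (Suc (p + n)) (w (p + n)))) \<partial>chain_law S M p D n)"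
  proof (rule nn_integral_cong)
    fix w assume "w \<in> space (chain_law S M p D n)"
    then have "w (p + n) \<in> space S"
      by (auto simp: sets_eq_imp_space_eq[OF law] space_PiM PiE_iff)
    then have sets_M: "sets (M (p + Suc n) (w (p + n))) = sets S"
      using p Suc.prems by (intro M_prob) auto
    have h': "h \<in> borel_measurable (M (p + Suc n) (w (p + n)))"
      using Suc.prems(2) by (simp only: measurable_cong_sets[OF sets_M refl])
    have W: "(\<Prod>k\<in>{p..<p + Suc n}. ennreal (G k ((w(p + Suc n := z)) k))) =
        ?W w * ennreal (G (p + n) (w (p + n)))" for z
      by simp
    show "(\<integral>\<^sup>+z. (\<Prod>k\<in>{p..<p + Suc n}. ennreal (G k ((w(p + Suc n := z)) k))) * h z
        \<partial>M (p + Suc n) (w (p + n))) =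
        ?W w * (ennreal (G (p + n) (w (p + n))) * (\<integral>\<^sup>+z. h z \<partial>M (Suc (p + n)) (w (p + n))))"
      unfolding W nn_integral_cmult[OF h'] by (simp add: mult.assoc)
  qed
  also have "\<dots> = (\<integral>\<^sup>+z. propagate p (Suc n) h z \<partial>D)"
    unfolding propagate.simps using p(1) Suc.prems
    by (intro Suc.IH measurable_weighted_M_integral) auto
  finally show ?case .
qed

text \<open>
  \<open>G_between\<close> and \<open>G_initial\<close> integrate over the chain up to time \<open>T\<close>, although their integrands stop at
  time \<open>q - 1\<close>; the superfluous transitions integrate to one.
\<close>

lemma nn_integral_chain_law_drop_last:
  assumes D: "D \<in> space (prob_algebra S)" and p: "1 \<le> p" "p + Suc n \<le> T" and q: "q \<le> p + Suc n"
  shows "(\<integral>\<^sup>+w. ennreal (\<Prod>k\<in>{p..<q}. G k (w k)) \<partial>chain_law S M p D (Suc n)) =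
    (\<integral>\<^sup>+w. ennreal (\<Prod>k\<in>{p..<q}. G k (w k)) \<partial>chain_law S M p D n)"
proof -
  have law: "sets (chain_law S M p D n) = sets (\<Pi>\<^sub>M k\<in>{p..p + n}. S)"
    using chain_law_in_prob_algebra[OF D p(1), of n] p(2) by (simp add: space_prob_algebra)
  have f: "(\<lambda>w. ennreal (\<Prod>k\<in>{p..<q}. G k (w k))) \<in> borel_measurable (\<Pi>\<^sub>M k\<in>{p..p + Suc n}. S)"
  proof (rule measurable_compose[OF borel_measurable_prod measurable_ennreal])
    fix k assume k: "k \<in> {p..<q}"
    show "(\<lambda>w. G k (w k)) \<in> borel_measurable (\<Pi>\<^sub>M k\<in>{p..p + Suc n}. S)"
      using k p q by (intro measurable_component_compose G_measurable) auto
  qed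
  show ?thesis
    unfolding nn_integral_chain_law_Suc[OF D p f]
  proof (rule nn_integral_cong)
    fix w assume "w \<in> space (chain_law S M p D n)"
    then have "w (p + n) \<in> space S"
      by (auto simp: sets_eq_imp_space_eq[OF law] space_PiM PiE_iff)
    then have "prob_space (M (p + Suc n) (w (p + n)))"
      using p by (intro M_prob) auto
    moreover have "(\<Prod>k\<in>{p..<q}. G k ((w(p + Suc n := z)) k)) = (\<Prod>k\<in>{p..<q}. G k (w k))" for z
      using q by (intro prod.cong) auto
    ultimately show "(\<integral>\<^sup>+z. ennreal (\<Prod>k\<in>{p..<q}. G k ((w(p + Suc n := z)) k)) \<partial>M (p + Suc n) (w (p + n))) =
        ennreal (\<Prod>k\<in>{p..<q}. G k (w k))"
      by (simp add: prob_space.emeasure_space_1)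
  qed
qed

lemma nn_integral_chain_law_potentials:
  assumes D: "D \<in> space (prob_algebra S)" and p: "1 \<le> p" "p + n \<le> T" and "m \<le> n"
  shows "(\<integral>\<^sup>+w. ennreal (\<Prod>k\<in>{p..<Suc (p + m)}. G k (w k)) \<partial>chain_law S M p D n) =
    (\<integral>\<^sup>+z. propagate p m (\<lambda>z. ennreal (G (p + m) z)) z \<partial>D)"
  using assms(4) p(2)
proof (induction n rule: dec_induct)
  case base
  have law: "sets (chain_law S M p D m) = sets (\<Pi>\<^sub>M k\<in>{p..p + m}. S)"
    using chain_law_in_prob_algebra[OF D p(1) base] by (simp add: space_prob_algebra)
  have "(\<integral>\<^sup>+w. ennreal (\<Prod>k\<in>{p..<Suc (p + m)}. G k (w k)) \<partial>chain_law S M p D m) =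
      (\<integral>\<^sup>+w. (\<Prod>k\<in>{p..<p + m}. ennreal (G k (w k))) * ennreal (G (p + m) (w (p + m))) \<partial>chain_law S M p D m)"
  proof (rule nn_integral_cong)
    fix w assume "w \<in> space (chain_law S M p D m)"
    then have "w k \<in> space S" if "k \<in> {p..p + m}" for k
      using that by (auto simp: sets_eq_imp_space_eq[OF law] space_PiM PiE_iff)
    then have "0 \<le> G k (w k)" if "k \<in> {p..<Suc (p + m)}" for k
      using that p(1) base by (intro G_nonneg) auto
    then have "ennreal (\<Prod>k\<in>{p..<Suc (p + m)}. G k (w k)) = (\<Prod>k\<in>{p..<Suc (p + m)}. ennreal (G k (w k)))"
      by (intro prod_ennreal[symmetric])
    then show "ennreal (\<Prod>k\<in>{p..<Suc (p + m)}. G k (w k)) =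
        (\<Prod>k\<in>{p..<p + m}. ennreal (G k (w k))) * ennreal (G (p + m) (w (p + m)))"
      by simp
  qed
  also have "\<dots> = (\<integral>\<^sup>+z. propagate p m (\<lambda>z. ennreal (G (p + m) z)) z \<partial>D)"
    using p(1) base
    by (intro nn_integral_chain_law_propagate[OF D] measurable_ennreal_G) auto
  finally show ?case .
next
  case (step n)
  then have "(\<integral>\<^sup>+w. ennreal (\<Prod>k\<in>{p..<Suc (p + m)}. G k (w k)) \<partial>chain_law S M p D (Suc n)) =
      (\<integral>\<^sup>+w. ennreal (\<Prod>k\<in>{p..<Suc (p + m)}. G k (w k)) \<partial>chain_law S M p D n)"
    by (intro nn_integral_chain_law_drop_last[OF D p(1)]) auto
  then show ?case
    using step by simp
qed

lemma G_between_eq_propagate: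
  assumes "1 \<le> p" "p < q" "q \<le> T + 1" and z: "z \<in> space S"
  shows "G_between S M G T p q z = propagate p (q - p - 1) (\<lambda>z. ennreal (G (q - 1) z)) z"
proof -
  have h: "(\<lambda>z. ennreal (G (q - 1) z)) \<in> borel_measurable S"
    using assms by (intro measurable_ennreal_G) auto
  have "return S z \<in> space (prob_algebra S)"
    using z by (simp add: space_prob_algebra prob_space_return)
  from nn_integral_chain_law_potentials[OF this assms(1), of "T - p" "q - p - 1"]
  have "G_between S M G T p q z =
      (\<integral>\<^sup>+z. propagate p (q - p - 1) (\<lambda>z. ennreal (G (q - 1) z)) z \<partial>return S z)"
    using assms by (simp add: G_between_def)
  also have "\<dots> = propagate p (q - p - 1) (\<lambda>z. ennreal (G (q - 1) z)) z"
    using assms by (intro nn_integral_return[OF z] measurable_propagate h) auto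
  finally show ?thesis .
qed

lemma measurable_G_between:
  assumes "1 \<le> p" "p < q" "q \<le> T + 1"
  shows "G_between S M G T p q \<in> borel_measurable S"
proof -
  have "propagate p (q - p - 1) (\<lambda>z. ennreal (G (q - 1) z)) \<in> borel_measurable S"
    using assms by (intro measurable_propagate measurable_ennreal_G) auto
  then show ?thesis
    using G_between_eq_propagate[OF assms] by (simp cong: measurable_cong)
qed

lemma G_between_one_step:
  assumes "1 \<le> p" "p \<le> T" "z \<in> space S"
  shows "G_between S M G T p (p + 1) z = ennreal (G p z)"
  using assms by (subst G_between_eq_propagate) auto

text \<open>
  The Markov property at the first step.
\<close>

lemma G_between_first_step:
  assumes "1 \<le> p" "p + 1 < q" "q \<le> T + 1" and z: "z \<in> space S"
  shows "G_between S M G T p q z =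
    ennreal (G p z) * (\<integral>\<^sup>+z'. G_between S M G T (p + 1) q z' \<partial>M (p + 1) z)"
proof -
  let ?h = "\<lambda>z. ennreal (G (q - 1) z)"
  have steps: "q - p - 1 = Suc (q - (p + 1) - 1)"
    using assms by auto
  have "G_between S M G T p q z = propagate p (q - p - 1) ?h z"
    using assms by (intro G_between_eq_propagate) auto
  also have "\<dots> = ennreal (G p z) * (\<integral>\<^sup>+z'. propagate (p + 1) (q - (p + 1) - 1) ?h z' \<partial>M (p + 1) z)"
    unfolding steps propagate_first_step by simp
  also have "(\<integral>\<^sup>+z'. propagate (p + 1) (q - (p + 1) - 1) ?h z' \<partial>M (p + 1) z) =
      (\<integral>\<^sup>+z'. G_between S M G T (p + 1) q z' \<partial>M (p + 1) z)"
    using assms M_prob(3)[of "p + 1" z]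
    by (intro nn_integral_cong G_between_eq_propagate[symmetric]) auto
  finally show ?thesis .
qed

lemma G_initial_eq_integral:
  assumes "2 \<le> q" "q \<le> T + 1"
  shows "G_initial S M1 M G T q = (\<integral>\<^sup>+z. G_between S M G T 1 q z \<partial>M1)"
proof -
  have index: "Suc (q - 1) = q" "1 + (q - 2) = q - 1" "q - 2 = q - 1 - 1"
    and bounds: "1 + (T - 1) \<le> T" "q - 2 \<le> T - 1"
    using assms by auto
  have "G_initial S M1 M G T q = (\<integral>\<^sup>+w. ennreal (\<Prod>k\<in>{1..<q}. G k (w k)) \<partial>chain_law S M 1 M1 (T - 1))"
    using assms by (simp add: G_initial_def)
  also have "\<dots> = (\<integral>\<^sup>+z. propagate 1 (q - 2) (\<lambda>z. ennreal (G (q - 1) z)) z \<partial>M1)"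
    using nn_integral_chain_law_potentials[OF M1_in_prob_algebra order_refl bounds]
    by (simp only: index(1,2))
  also have "\<dots> = (\<integral>\<^sup>+z. G_between S M G T 1 q z \<partial>M1)"
    unfolding index(3) using assms space_M1
    by (intro nn_integral_cong G_between_eq_propagate[symmetric]) auto
  finally show ?thesis .
qed

end

section \<open>The law of the particle system\<close>

locale doubly_conditional_smc = feynman_kac S M1 M G T
  for S M1 :: "'a measure" and M :: "nat \<Rightarrow> 'a \<Rightarrow> 'a measure" and G :: "nat \<Rightarrow> 'a \<Rightarrow> real" and T :: nat +
  fixes N :: nat and x y :: "nat \<Rightarrow> 'a"
  assumes N: "2 \<le> N" and x: "x \<in> {1..T} \<rightarrow> space S" and y: "y \<in> {1..T} \<rightarrow> space S"
begin

lemma imposed_states: "t \<in> {1..T} \<Longrightarrow> x t \<in> space S" "t \<in> {1..T} \<Longrightarrow> y t \<in> space S"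
  using x y by auto

text \<open>
  The backward recursion \<open>H\<close> of the introduction.  It is the contribution of one particle at \<open>z\<close> at time \<open>t\<close>
  to the conditional expectation of \<open>W\<^sub>t ... W\<^sub>T\<close> given the particles at time \<open>t\<close>.
\<close>

function future_weight :: "nat \<Rightarrow> 'a \<Rightarrow> ennreal" where
  "future_weight t z = ennreal (G t z) *
    (if t < T then future_weight (Suc t) (x (Suc t)) + future_weight (Suc t) (y (Suc t)) +
       of_nat (N - 2) * (\<integral>\<^sup>+z'. future_weight (Suc t) z' \<partial>M (Suc t) z)
     else 1)"
  by pat_completeness auto
termination
  by (relation "Wellfounded.measure (\<lambda>(t, z). T - t)") auto

declare future_weight.simps [simp del]

lemma future_weight_last: "future_weight T z = ennreal (G T z)"
  by (subst future_weight.simps) simp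

lemma future_weight_step:
  assumes "t < T"
  shows "future_weight t z = ennreal (G t z) *
    (future_weight (Suc t) (x (Suc t)) + future_weight (Suc t) (y (Suc t)) +
      of_nat (N - 2) * (\<integral>\<^sup>+z'. future_weight (Suc t) z' \<partial>M (Suc t) z))"
  using assms by (subst future_weight.simps) simp

lemma measurable_future_weight:
  assumes "t \<le> T" "1 \<le> t"
  shows "future_weight t \<in> borel_measurable S"
  using assms
proof (induction t rule: inc_induct)
  case base
  then show ?case
    using measurable_ennreal_G[of T] by (simp add: future_weight_last[abs_def])
next
  case (step t)
  have [measurable]: "(\<lambda>z. ennreal (G t z)) \<in> borel_measurable S"
    using step by (intro measurable_ennreal_G) auto
  have [measurable]: "(\<lambda>z. \<integral>\<^sup>+z'. future_weight (Suc t) z' \<partial>M (Suc t) z) \<in> borel_measurable S"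
    using step by (intro measurable_M_integral) auto
  show ?case
    unfolding future_weight_step[OF step.hyps(2), abs_def] by measurable
qed

lemma measurable_particle:
  assumes "t \<in> {1..n}" "j \<in> {1..N}" "h \<in> borel_measurable S"
  shows "(\<lambda>p. h (fst p t j)) \<in> borel_measurable (history_space N S n)"
proof -
  have "(\<lambda>z. h (z j)) \<in> borel_measurable (\<Pi>\<^sub>M i\<in>{1..N}. S)"
    by (rule measurable_component_compose[where h = h and R = "\<lambda>_. S"]) (fact assms)+
  with assms(1) have "(\<lambda>Z. h (Z t j)) \<in> borel_measurable (\<Pi>\<^sub>M k\<in>{1..n}. \<Pi>\<^sub>M i\<in>{1..N}. S)"
    by (rule measurable_component_compose[where h = "\<lambda>z. h (z j)" and R = "\<lambda>_. \<Pi>\<^sub>M i\<in>{1..N}. S"])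
  from measurable_compose[OF measurable_fst this] show ?thesis
    unfolding history_space_def .
qed

lemma particle_in_space:
  assumes "p \<in> space (history_space N S n)" "t \<in> {1..n}"
  shows "fst p t \<in> space (\<Pi>\<^sub>M i\<in>{1..N}. S)" and "j \<in> {1..N} \<Longrightarrow> fst p t j \<in> space S"
  using assms by (auto simp: history_space_def space_pair_measure space_PiM PiE_iff)

lemma measurable_append_history:
  "(\<lambda>(p, u). ((fst p)(n + 2 := \<lambda>i\<in>{1..N}. snd (u i)), (snd p)(n + 1 := \<lambda>i\<in>{1..N}. fst (u i))))
    \<in> history_space N S (n + 1) \<Otimes>\<^sub>M (\<Pi>\<^sub>M i\<in>{1..N}. count_space {1..N} \<Otimes>\<^sub>M S)
      \<rightarrow>\<^sub>M history_space N S (n + 2)"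
proof -
  let ?L = "history_space N S (n + 1) \<Otimes>\<^sub>M (\<Pi>\<^sub>M i\<in>{1..N}. count_space {1..N} \<Otimes>\<^sub>M S)"
  have component: "(\<lambda>q. snd q i) \<in> ?L \<rightarrow>\<^sub>M count_space {1..N} \<Otimes>\<^sub>M S" if "i \<in> {1..N}" for i
    by (rule measurable_compose[OF measurable_snd measurable_component_singleton[OF that]])
  have "(\<lambda>q. fst (fst q)) \<in> ?L \<rightarrow>\<^sub>M (\<Pi>\<^sub>M k\<in>{1..n + 1}. \<Pi>\<^sub>M i\<in>{1..N}. S)"
    unfolding history_space_def by (rule measurable_compose[OF measurable_fst measurable_fst])
  moreover have "(\<lambda>q. \<lambda>i\<in>{1..N}. snd (snd q i)) \<in> ?L \<rightarrow>\<^sub>M (\<Pi>\<^sub>M i\<in>{1..N}. S)"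
    by (rule measurable_restrict) (rule measurable_compose[OF component measurable_snd])
  ultimately have particles: "(\<lambda>q. (fst (fst q))(n + 2 := \<lambda>i\<in>{1..N}. snd (snd q i)))
      \<in> ?L \<rightarrow>\<^sub>M (\<Pi>\<^sub>M k\<in>{1..n + 2}. \<Pi>\<^sub>M i\<in>{1..N}. S)"
    by (rule measurable_fun_upd[rotated]) auto
  have "(\<lambda>q. snd (fst q)) \<in> ?L \<rightarrow>\<^sub>M (\<Pi>\<^sub>M k\<in>{1..<n + 1}. \<Pi>\<^sub>M i\<in>{1..N}. count_space {1..N})"
    unfolding history_space_def by (rule measurable_compose[OF measurable_fst measurable_snd])
  moreover have "(\<lambda>q. \<lambda>i\<in>{1..N}. fst (snd q i)) \<in> ?L \<rightarrow>\<^sub>M (\<Pi>\<^sub>M i\<in>{1..N}. count_space {1..N})"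
    by (rule measurable_restrict) (rule measurable_compose[OF component measurable_fst])
  ultimately have ancestors: "(\<lambda>q. (snd (fst q))(n + 1 := \<lambda>i\<in>{1..N}. fst (snd q i)))
      \<in> ?L \<rightarrow>\<^sub>M (\<Pi>\<^sub>M k\<in>{1..<n + 2}. \<Pi>\<^sub>M i\<in>{1..N}. count_space {1..N})"
    by (rule measurable_fun_upd[rotated]) auto
  have "(\<lambda>q. ((fst (fst q))(n + 2 := \<lambda>i\<in>{1..N}. snd (snd q i)),
      (snd (fst q))(n + 1 := \<lambda>i\<in>{1..N}. fst (snd q i)))) \<in> ?L \<rightarrow>\<^sub>M history_space N S (n + 2)"
    unfolding history_space_def[of N S "n + 2"]
    by (rule measurable_Pair[OF particles ancestors])
  then show ?thesis
    unfolding case_prod_beta .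
qed

abbreviation next_generation :: "nat \<Rightarrow> (nat \<Rightarrow> 'a) \<Rightarrow> (nat \<Rightarrow> nat \<times> 'a) measure" where
  "next_generation n \<equiv> c2smc_step N S (G (n + 1)) (M (n + 2)) (x (n + 2)) (y (n + 2))"

lemma measurable_next_generation:
  assumes "n + 2 \<le> T"
  shows "next_generation n
    \<in> (\<Pi>\<^sub>M i\<in>{1..N}. S) \<rightarrow>\<^sub>M prob_algebra (\<Pi>\<^sub>M i\<in>{1..N}. count_space {1..N} \<Otimes>\<^sub>M S)"
proof (rule measurable_c2smc_step[OF N])
  show "G (n + 1) \<in> borel_measurable S" "M (n + 2) \<in> S \<rightarrow>\<^sub>M prob_algebra S"
    "x (n + 2) \<in> space S" "y (n + 2) \<in> space S"
    using assms by (auto intro!: G_measurable M_kernel imposed_states)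
  show "0 \<le> G (n + 1) z" if "z \<in> space S" for z
    using assms that by (intro G_nonneg) auto
qed

lemma c2smc_kernel:
  assumes "n + 2 \<le> T"
  shows "(\<lambda>(Z, A). distr (next_generation n (Z (n + 1))) (history_space N S (n + 2))
      (\<lambda>u. (Z(n + 2 := \<lambda>i\<in>{1..N}. snd (u i)), A(n + 1 := \<lambda>i\<in>{1..N}. fst (u i)))))
    \<in> history_space N S (n + 1) \<rightarrow>\<^sub>M prob_algebra (history_space N S (n + 2))"
  unfolding case_prod_beta
proof (rule measurable_distr_prob_space2)
  have "(\<lambda>Z. next_generation n (Z (n + 1))) \<in> (\<Pi>\<^sub>M k\<in>{1..n + 1}. \<Pi>\<^sub>M i\<in>{1..N}. S)
      \<rightarrow>\<^sub>M prob_algebra (\<Pi>\<^sub>M i\<in>{1..N}. count_space {1..N} \<Otimes>\<^sub>M S)"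
    by (rule measurable_component_compose[where h = "next_generation n" and R = "\<lambda>_. \<Pi>\<^sub>M i\<in>{1..N}. S"])
      (simp, rule measurable_next_generation[OF assms])
  from measurable_compose[OF measurable_fst this]
  show "(\<lambda>p. next_generation n (fst p (n + 1))) \<in> history_space N S (n + 1)
      \<rightarrow>\<^sub>M prob_algebra (\<Pi>\<^sub>M i\<in>{1..N}. count_space {1..N} \<Otimes>\<^sub>M S)"
    unfolding history_space_def .
  show "(\<lambda>(p, u). ((fst p)(n + 2 := \<lambda>i\<in>{1..N}. snd (u i)), (snd p)(n + 1 := \<lambda>i\<in>{1..N}. fst (u i))))
    \<in> history_space N S (n + 1) \<Otimes>\<^sub>M (\<Pi>\<^sub>M i\<in>{1..N}. count_space {1..N} \<Otimes>\<^sub>M S)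
      \<rightarrow>\<^sub>M history_space N S (n + 2)"
    by (rule measurable_append_history)
qed

lemma measurable_initial_history:
  "(\<lambda>z. (\<lambda>k\<in>{1..1}. z, \<lambda>k. undefined)) \<in> (\<Pi>\<^sub>M i\<in>{1..N}. S) \<rightarrow>\<^sub>M history_space N S 1"
proof -
  have "(\<lambda>z. \<lambda>k\<in>{1..1}. z) \<in> (\<Pi>\<^sub>M i\<in>{1..N}. S) \<rightarrow>\<^sub>M (\<Pi>\<^sub>M k\<in>{1..1}. \<Pi>\<^sub>M i\<in>{1..N}. S)"
    by (rule measurable_restrict) (rule measurable_ident_sets[OF refl])
  moreover have "(\<lambda>z. \<lambda>k. undefined) \<in> (\<Pi>\<^sub>M i\<in>{1..N}. S)
      \<rightarrow>\<^sub>M (\<Pi>\<^sub>M k\<in>{1..<1::nat}. \<Pi>\<^sub>M i\<in>{1..N}. count_space {1..N})"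
    by (rule measurable_const) (simp add: space_PiM)
  ultimately show ?thesis
    unfolding history_space_def by (rule measurable_Pair)
qed

lemma c2smc_upto_in_prob_algebra:
  assumes "n + 1 \<le> T"
  shows "c2smc_upto N S M1 M G x y n \<in> space (prob_algebra (history_space N S (n + 1)))"
  using assms
proof (induction n)
  case 0
  then have "c2smc_init N S M1 (x 1) (y 1) \<in> space (prob_algebra (\<Pi>\<^sub>M i\<in>{1..N}. S))"
    by (intro c2smc_init_in_prob_algebra M1_prob sets_M1 imposed_states) auto
  from measurable_space[OF measurable_distr_prob_space[OF measurable_initial_history] this]
  show ?case
    by simp
next
  case (Suc n)
  then have law: "c2smc_upto N S M1 M G x y n \<in> space (prob_algebra (history_space N S (n + 1)))"
    and n: "n + 2 \<le> T"
    by simp_all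
  show ?case
    using prob_space_bind'[OF law c2smc_kernel[OF n]] sets_bind'[OF law c2smc_kernel[OF n]]
    by (simp add: space_prob_algebra)
qed

lemma nn_integral_c2smc_upto_0:
  assumes "1 \<le> T" and f: "f \<in> borel_measurable (history_space N S 1)"
  shows "(\<integral>\<^sup>+p. f p \<partial>c2smc_upto N S M1 M G x y 0) =
    (\<integral>\<^sup>+z. f (\<lambda>k\<in>{1..1}. z, \<lambda>k. undefined) \<partial>c2smc_init N S M1 (x 1) (y 1))"
proof -
  have "c2smc_init N S M1 (x 1) (y 1) \<in> space (prob_algebra (\<Pi>\<^sub>M i\<in>{1..N}. S))"
    using assms(1) by (intro c2smc_init_in_prob_algebra M1_prob sets_M1 imposed_states) auto
  then have law: "sets (c2smc_init N S M1 (x 1) (y 1)) = sets (\<Pi>\<^sub>M i\<in>{1..N}. S)"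
    by (simp add: space_prob_algebra)
  have "(\<lambda>z. (\<lambda>k\<in>{1..1}. z, \<lambda>k. undefined)) \<in> c2smc_init N S M1 (x 1) (y 1) \<rightarrow>\<^sub>M history_space N S 1"
    unfolding measurable_cong_sets[OF law refl] by (rule measurable_initial_history)
  then show ?thesis
    unfolding c2smc_upto.simps using f by (rule nn_integral_distr[unfolded measurable_distr_eq1])
qed

lemma nn_integral_c2smc_upto_Suc:
  assumes n: "n + 2 \<le> T" and f: "f \<in> borel_measurable (history_space N S (n + 2))"
  shows "(\<integral>\<^sup>+p. f p \<partial>c2smc_upto N S M1 M G x y (Suc n)) =
    (\<integral>\<^sup>+p. (\<integral>\<^sup>+u. f ((fst p)(n + 2 := \<lambda>i\<in>{1..N}. snd (u i)), (snd p)(n + 1 := \<lambda>i\<in>{1..N}. fst (u i)))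
      \<partial>next_generation n (fst p (n + 1))) \<partial>c2smc_upto N S M1 M G x y n)"
proof -
  let ?K = "\<lambda>(Z, A). distr (next_generation n (Z (n + 1))) (history_space N S (n + 2))
      (\<lambda>u. (Z(n + 2 := \<lambda>i\<in>{1..N}. snd (u i)), A(n + 1 := \<lambda>i\<in>{1..N}. fst (u i))))"
  have law: "sets (c2smc_upto N S M1 M G x y n) = sets (history_space N S (n + 1))"
    using c2smc_upto_in_prob_algebra[of n] n by (simp add: space_prob_algebra)
  have kernel: "?K \<in> c2smc_upto N S M1 M G x y n \<rightarrow>\<^sub>M subprob_algebra (history_space N S (n + 2))"
    unfolding measurable_cong_sets[OF law refl]
    by (rule measurable_prob_algebraD[OF c2smc_kernel[OF n]])
  show ?thesis
    unfolding c2smc_upto.simps nn_integral_bind[OF f kernel]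
  proof (rule nn_integral_cong)
    fix p assume "p \<in> space (c2smc_upto N S M1 M G x y n)"
    then have p: "p \<in> space (history_space N S (n + 1))"
      by (simp only: sets_eq_imp_space_eq[OF law])
    then have "next_generation n (fst p (n + 1)) \<in> space (prob_algebra (\<Pi>\<^sub>M i\<in>{1..N}. count_space {1..N} \<Otimes>\<^sub>M S))"
      by (intro measurable_space[OF measurable_next_generation[OF n]] particle_in_space) auto
    then have step: "sets (next_generation n (fst p (n + 1))) = sets (\<Pi>\<^sub>M i\<in>{1..N}. count_space {1..N} \<Otimes>\<^sub>M S)"
      by (simp add: space_prob_algebra)
    have "(\<lambda>u. ((fst p)(n + 2 := \<lambda>i\<in>{1..N}. snd (u i)), (snd p)(n + 1 := \<lambda>i\<in>{1..N}. fst (u i))))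
        \<in> (\<Pi>\<^sub>M i\<in>{1..N}. count_space {1..N} \<Otimes>\<^sub>M S) \<rightarrow>\<^sub>M history_space N S (n + 2)"
      using measurable_Pair2[OF measurable_append_history[of n] p] unfolding prod.case .
    then have "(\<lambda>u. ((fst p)(n + 2 := \<lambda>i\<in>{1..N}. snd (u i)), (snd p)(n + 1 := \<lambda>i\<in>{1..N}. fst (u i))))
        \<in> next_generation n (fst p (n + 1)) \<rightarrow>\<^sub>M history_space N S (n + 2)"
      unfolding measurable_cong_sets[OF step refl] .
    then show "(\<integral>\<^sup>+p. f p \<partial>?K p) =
        (\<integral>\<^sup>+u. f ((fst p)(n + 2 := \<lambda>i\<in>{1..N}. snd (u i)), (snd p)(n + 1 := \<lambda>i\<in>{1..N}. fst (u i)))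
          \<partial>next_generation n (fst p (n + 1)))"
      unfolding case_prod_beta using f by (rule nn_integral_distr[unfolded measurable_distr_eq1])
  qed
qed

section \<open>The backward recursion for the expected product of weights\<close>

definition total_weight :: "nat \<Rightarrow> (nat \<Rightarrow> 'a) \<Rightarrow> ennreal" where
  "total_weight t z = (\<Sum>j\<in>{1..N}. ennreal (G t (z j)))"

definition total_future_weight :: "nat \<Rightarrow> (nat \<Rightarrow> 'a) \<Rightarrow> ennreal" where
  "total_future_weight t z = (\<Sum>j\<in>{1..N}. future_weight t (z j))"

text \<open>
  One step backwards in time: the expected sum of the future weights, multiplied by the total weight,
  is again a sum of future weights over the particles.
\<close>

lemma total_weight_times_expected_future_weight:
  assumes n: "n + 2 \<le> T" and z: "z \<in> space (\<Pi>\<^sub>M i\<in>{1..N}. S)"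
  shows "total_weight (n + 1) z *
      (\<integral>\<^sup>+u. (\<Sum>j\<in>{1..N}. future_weight (n + 2) (snd (u j))) \<partial>next_generation n z) =
    total_future_weight (n + 1) z"
proof -
  let ?c = "of_nat (N - 2) :: ennreal" and ?t = "n + 2"
  let ?C = "future_weight ?t (x ?t) + future_weight ?t (y ?t)"
  let ?Mh = "\<lambda>v. \<integral>\<^sup>+z'. future_weight ?t z' \<partial>M ?t v"
  have G: "0 \<le> G (n + 1) v" if "v \<in> space S" for v
    using n that by (intro G_nonneg) auto
  have G_z: "0 \<le> G (n + 1) (z l)" if "l \<in> {1..N}" for l
    using z that by (intro G) (auto simp: space_PiM PiE_iff)
  have "(\<integral>\<^sup>+u. (\<Sum>j\<in>{1..N}. future_weight ?t (snd (u j))) \<partial>next_generation n z) =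
      ?C + ?c * (\<integral>\<^sup>+l. ?Mh (z l) \<partial>ancestor_law N (\<lambda>l. G (n + 1) (z l)))"
  proof (rule nn_integral_c2smc_step[OF N])
    show "G (n + 1) \<in> borel_measurable S" "M ?t \<in> S \<rightarrow>\<^sub>M prob_algebra S"
      "x ?t \<in> space S" "y ?t \<in> space S" "future_weight ?t \<in> borel_measurable S"
      using n by (auto intro!: G_measurable M_kernel imposed_states measurable_future_weight)
  qed (fact G z)+
  then have "total_weight (n + 1) z *
      (\<integral>\<^sup>+u. (\<Sum>j\<in>{1..N}. future_weight ?t (snd (u j))) \<partial>next_generation n z) =
    (\<Sum>j\<in>{1..N}. ennreal (G (n + 1) (z j))) * ?C +
      ?c * ((\<Sum>j\<in>{1..N}. ennreal (G (n + 1) (z j))) * (\<integral>\<^sup>+l. ?Mh (z l) \<partial>ancestor_law N (\<lambda>l. G (n + 1) (z l))))"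
    by (simp only: total_weight_def distrib_left mult.left_commute)
  also have "\<dots> = (\<Sum>j\<in>{1..N}. ennreal (G (n + 1) (z j))) * ?C +
      ?c * (\<Sum>l\<in>{1..N}. ennreal (G (n + 1) (z l)) * ?Mh (z l))"
    by (simp only: total_weight_times_ancestor_mean[OF G_z])
  also have "\<dots> = (\<Sum>l\<in>{1..N}. ennreal (G (n + 1) (z l)) * (?C + ?c * ?Mh (z l)))"
    by (simp only: sum_distrib_left sum_distrib_right distrib_left sum.distrib ac_simps)
  also have "\<dots> = total_future_weight (n + 1) z"
    using n by (simp add: total_future_weight_def future_weight_step)
  finally show ?thesis .
qed

lemma measurable_total_weight:
  assumes "t \<in> {1..n}" "n \<le> T"
  shows "(\<lambda>p. total_weight t (fst p t)) \<in> borel_measurable (history_space N S n)"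
  unfolding total_weight_def using assms
  by (intro borel_measurable_sum measurable_particle[where h = "\<lambda>z. ennreal (G t z)"] measurable_ennreal_G) auto

lemma measurable_total_future_weight:
  assumes "t \<in> {1..n}" "n \<le> T"
  shows "(\<lambda>p. total_future_weight t (fst p t)) \<in> borel_measurable (history_space N S n)"
  unfolding total_future_weight_def using assms
  by (intro borel_measurable_sum measurable_particle measurable_future_weight) auto

text \<open>
  The expectation on the left does not depend on \<open>n\<close>: replacing \<open>n + 1\<close> by \<open>n\<close> is the step above, and at
  \<open>n = 0\<close> only the initial particles are left.
\<close>

lemma expected_weights_times_future_weight:
  assumes "n + 1 \<le> T"
  shows "(\<integral>\<^sup>+p. (\<Prod>t\<in>{1..n}. total_weight t (fst p t)) * total_future_weight (n + 1) (fst p (n + 1))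
      \<partial>c2smc_upto N S M1 M G x y n) =
    future_weight 1 (x 1) + future_weight 1 (y 1) + of_nat (N - 2) * (\<integral>\<^sup>+z. future_weight 1 z \<partial>M1)"
  using assms
proof (induction n)
  case 0
  have "(\<lambda>p. total_future_weight 1 (fst p 1)) \<in> borel_measurable (history_space N S 1)"
    using 0 by (intro measurable_total_future_weight) auto
  then have "(\<integral>\<^sup>+p. total_future_weight 1 (fst p 1) \<partial>c2smc_upto N S M1 M G x y 0) =
      (\<integral>\<^sup>+z. (\<Sum>j\<in>{1..N}. future_weight 1 (z j)) \<partial>c2smc_init N S M1 (x 1) (y 1))"
    using 0 by (subst nn_integral_c2smc_upto_0) (auto simp: total_future_weight_def)
  also have "\<dots> = future_weight 1 (x 1) + future_weight 1 (y 1) +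
      of_nat (N - 2) * (\<integral>\<^sup>+z. future_weight 1 z \<partial>M1)"
    using 0 by (intro nn_integral_c2smc_init N M1_prob sets_M1 imposed_states measurable_future_weight) auto
  finally show ?case
    by simp
next
  case (Suc n)
  then have n: "n + 2 \<le> T"
    by simp
  let ?W = "\<lambda>p. \<Prod>t\<in>{1..n}. total_weight t (fst p t)"
  have law: "sets (c2smc_upto N S M1 M G x y n) = sets (history_space N S (n + 1))"
    using c2smc_upto_in_prob_algebra[of n] n by (simp add: space_prob_algebra)
  let ?f = "\<lambda>p. (\<Prod>t\<in>{1..n + 1}. total_weight t (fst p t)) * total_future_weight (n + 2) (fst p (n + 2))"
  have f: "?f \<in> borel_measurable (history_space N S (n + 2))"
    using n by (intro borel_measurable_times_ennreal borel_measurable_prod_ennreal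
        measurable_total_weight measurable_total_future_weight) auto
  have "(\<integral>\<^sup>+p. ?f p \<partial>c2smc_upto N S M1 M G x y (Suc n)) =
      (\<integral>\<^sup>+p. (\<integral>\<^sup>+u. ?f ((fst p)(n + 2 := \<lambda>i\<in>{1..N}. snd (u i)), (snd p)(n + 1 := \<lambda>i\<in>{1..N}. fst (u i)))
        \<partial>next_generation n (fst p (n + 1))) \<partial>c2smc_upto N S M1 M G x y n)"
    by (rule nn_integral_c2smc_upto_Suc[OF n f])
  also have "\<dots> = (\<integral>\<^sup>+p. ?W p * total_future_weight (n + 1) (fst p (n + 1)) \<partial>c2smc_upto N S M1 M G x y n)"
  proof (rule nn_integral_cong)
    fix p assume "p \<in> space (c2smc_upto N S M1 M G x y n)"
    then have "p \<in> space (history_space N S (n + 1))"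
      by (simp only: sets_eq_imp_space_eq[OF law])
    then have z: "fst p (n + 1) \<in> space (\<Pi>\<^sub>M i\<in>{1..N}. S)"
      by (rule particle_in_space) simp
    let ?F = "\<lambda>u. \<Sum>j\<in>{1..N}. future_weight (n + 2) (snd (u j))"
    have W: "?f ((fst p)(n + 2 := \<lambda>i\<in>{1..N}. snd (u i)), A) = (?W p * total_weight (n + 1) (fst p (n + 1))) * ?F u"
      for u A
    proof -
      have "(\<Prod>t\<in>{1..n + 1}. total_weight t (((fst p)(n + 2 := \<lambda>i\<in>{1..N}. snd (u i))) t)) =
          (\<Prod>t\<in>{1..n + 1}. total_weight t (fst p t))"
        by (rule prod.cong) auto
      moreover have "(\<Prod>t\<in>{1..n + 1}. total_weight t (fst p t)) = ?W p * total_weight (n + 1) (fst p (n + 1))"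
        by simp
      moreover have "total_future_weight (n + 2) (\<lambda>i\<in>{1..N}. snd (u i)) = ?F u"
        unfolding total_future_weight_def by (rule sum.cong) auto
      ultimately show ?thesis
        by (simp only: fst_conv fun_upd_same)
    qed
    have step: "sets (next_generation n (fst p (n + 1))) = sets (\<Pi>\<^sub>M i\<in>{1..N}. count_space {1..N} \<Otimes>\<^sub>M S)"
      using measurable_space[OF measurable_next_generation[OF n] z] by (simp add: space_prob_algebra)
    have "future_weight (n + 2) \<in> borel_measurable S"
      using n by (intro measurable_future_weight) auto
    then have "(\<lambda>v. future_weight (n + 2) (snd v)) \<in> borel_measurable (count_space {1..N} \<Otimes>\<^sub>M S)"
      by (rule measurable_compose[OF measurable_snd])
    then have F: "?F \<in> borel_measurable (next_generation n (fst p (n + 1)))"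
      unfolding measurable_cong_sets[OF step refl]
      by (intro borel_measurable_sum measurable_component_compose[where h = "\<lambda>v. future_weight (n + 2) (snd v)"])
    have "(\<integral>\<^sup>+u. ?f ((fst p)(n + 2 := \<lambda>i\<in>{1..N}. snd (u i)), (snd p)(n + 1 := \<lambda>i\<in>{1..N}. fst (u i)))
        \<partial>next_generation n (fst p (n + 1))) =
        ?W p * (total_weight (n + 1) (fst p (n + 1)) * (\<integral>\<^sup>+u. ?F u \<partial>next_generation n (fst p (n + 1))))"
      unfolding W nn_integral_cmult[OF F] by (rule mult.assoc)
    then show "(\<integral>\<^sup>+u. ?f ((fst p)(n + 2 := \<lambda>i\<in>{1..N}. snd (u i)), (snd p)(n + 1 := \<lambda>i\<in>{1..N}. fst (u i)))
        \<partial>next_generation n (fst p (n + 1))) = ?W p * total_future_weight (n + 1) (fst p (n + 1))"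
      by (simp only: total_weight_times_expected_future_weight[OF n z])
  qed
  finally show ?case
    using Suc by simp
qed

lemma expected_gamma_hat:
  assumes "1 \<le> T"
  shows "(\<integral>\<^sup>+(Z, A). ennreal (gamma_hat T N G Z) \<partial>c2smc_law T N S M1 M G x y) =
    1 / of_nat N ^ T *
    (future_weight 1 (x 1) + future_weight 1 (y 1) + of_nat (N - 2) * (\<integral>\<^sup>+z. future_weight 1 z \<partial>M1))"
proof -
  let ?W = "\<lambda>p. (\<Prod>t\<in>{1..T - 1}. total_weight t (fst p t)) * total_future_weight (T - 1 + 1) (fst p (T - 1 + 1))"
  have T: "T - 1 + 1 = T"
    using assms by simp
  have law: "sets (c2smc_upto N S M1 M G x y (T - 1)) = sets (history_space N S T)"
    using c2smc_upto_in_prob_algebra[of "T - 1"] T by (simp add: space_prob_algebra)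
  have gamma_hat: "ennreal (gamma_hat T N G (fst p)) = 1 / of_nat N ^ T * ?W p"
    if p: "p \<in> space (history_space N S T)" for p
  proof -
    have G: "0 \<le> G t (fst p t j)" if "t \<in> {1..T}" "j \<in> {1..N}" for t j
      using particle_in_space(2)[OF p] that by (intro G_nonneg) auto
    have "ennreal (gamma_hat T N G (fst p)) =
        (\<Prod>t\<in>{1..T}. ennreal (1 / real N * (\<Sum>j\<in>{1..N}. G t (fst p t j))))"
      unfolding gamma_hat_def using G
      by (intro prod_ennreal[symmetric] mult_nonneg_nonneg sum_nonneg) auto
    also have "\<dots> = (\<Prod>t\<in>{1..T}. ennreal (1 / real N) * total_weight t (fst p t))"
    proof (rule prod.cong[OF refl])
      fix t assume t: "t \<in> {1..T}"
      then show "ennreal (1 / real N * (\<Sum>j\<in>{1..N}. G t (fst p t j))) =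
          ennreal (1 / real N) * total_weight t (fst p t)"
        unfolding total_weight_def using G[OF t]
        by (subst sum_ennreal, blast) (rule ennreal_mult, simp, rule sum_nonneg, blast)
    qed
    also have "\<dots> = ennreal (1 / real N) ^ T * (\<Prod>t\<in>{1..T}. total_weight t (fst p t))"
      by (simp add: prod.distrib)
    also have "(\<Prod>t\<in>{1..T}. total_weight t (fst p t)) =
        (\<Prod>t\<in>{1..T - 1}. total_weight t (fst p t)) * total_weight T (fst p T)"
      using assms by (cases T) simp_all
    also have "\<dots> = ?W p"
      unfolding T by (simp only: total_weight_def total_future_weight_def future_weight_last)
    also have "ennreal (1 / real N) ^ T = 1 / of_nat N ^ T"
    proof -
      have "ennreal (1 / real N) ^ T = ennreal (1 / real N ^ T)"
        by (simp add: ennreal_power power_one_over)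
      also have "\<dots> = ennreal 1 / ennreal (real N ^ T)"
        using N by (intro divide_ennreal[symmetric]) auto
      also have "\<dots> = 1 / of_nat N ^ T"
        by (simp add: ennreal_of_nat_eq_real_of_nat flip: ennreal_power)
      finally show ?thesis .
    qed
    finally show ?thesis .
  qed
  have W: "?W \<in> borel_measurable (c2smc_upto N S M1 M G x y (T - 1))"
    unfolding measurable_cong_sets[OF law refl] using assms
    by (intro borel_measurable_times_ennreal borel_measurable_prod_ennreal
        measurable_total_weight measurable_total_future_weight) auto
  have "(\<integral>\<^sup>+(Z, A). ennreal (gamma_hat T N G Z) \<partial>c2smc_law T N S M1 M G x y) =
      (\<integral>\<^sup>+p. 1 / of_nat N ^ T * ?W p \<partial>c2smc_upto N S M1 M G x y (T - 1))"
    unfolding c2smc_law_def case_prod_beta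
    by (rule nn_integral_cong) (simp only: gamma_hat sets_eq_imp_space_eq[OF law])
  also have "\<dots> = 1 / of_nat N ^ T * (\<integral>\<^sup>+p. ?W p \<partial>c2smc_upto N S M1 M G x y (T - 1))"
    by (rule nn_integral_cmult[OF W])
  also have "(\<integral>\<^sup>+p. ?W p \<partial>c2smc_upto N S M1 M G x y (T - 1)) = future_weight 1 (x 1) + future_weight 1 (y 1) +
      of_nat (N - 2) * (\<integral>\<^sup>+z. future_weight 1 z \<partial>M1)"
    using T by (intro expected_weights_times_future_weight) simp
  finally show ?thesis .
qed

section \<open>Solving the recursion\<close>

text \<open>
  The coefficient of the renewal equation: the two imposed states at time \<open>p\<close> act like sources whose
  contributions add up.
\<close>

abbreviation imposed_between :: "nat \<Rightarrow> nat \<Rightarrow> ennreal" where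
  "imposed_between p q \<equiv> G_between S M G T p q (x p) + G_between S M G T p q (y p)"

abbreviation renewal_weight :: "nat \<Rightarrow> ennreal" where
  "renewal_weight \<equiv> spaced_chain_sum T imposed_between (of_nat (N - 2))"

lemma renewal_weight_from_future_weight:
  assumes "q \<in> {1..T}"
    and "\<And>z. z \<in> space S \<Longrightarrow> future_weight q z =
      (\<Sum>r\<in>{q<..T + 1}. G_between S M G T q r z * (of_nat (N - 2) ^ (r - q - 1) * renewal_weight r))"
  shows "renewal_weight q = future_weight q (x q) + future_weight q (y q)"
  using assms(1) imposed_states[OF assms(1)]
  by (simp add: spaced_chain_sum_rec assms(2) distrib_right sum.distrib mult.assoc)

text \<open>
  Solving the backward recursion.  Here \<open>r\<close> is the first time after \<open>t\<close> at which the recursion takes an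
  imposed state (or \<open>T + 1\<close> if there is none); up to \<open>r\<close> the free transitions build up \<open>G\<^sub>t\<^sub>,\<^sub>r\<close> and each of
  them brings a factor \<open>N - 2\<close>.
\<close>

lemma future_weight_eq_sum:
  assumes "t \<le> T" "1 \<le> t" "z \<in> space S"
  shows "future_weight t z =
    (\<Sum>r\<in>{t<..T + 1}. G_between S M G T t r z * (of_nat (N - 2) ^ (r - t - 1) * renewal_weight r))"
  using assms
proof (induction t arbitrary: z rule: inc_induct)
  case base
  have "{T<..T + 1} = {T + 1}"
    by auto
  then show ?case
    using base G_between_one_step[of T z] spaced_chain_sum_last[of T imposed_between "of_nat (N - 2)"]
    by (simp add: future_weight_last)
next
  case (step t)
  let ?c = "of_nat (N - 2) :: ennreal"
  let ?g = "\<lambda>r. ?c ^ (r - Suc t - 1) * renewal_weight r"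
  have IH: "future_weight (Suc t) z = (\<Sum>r\<in>{Suc t<..T + 1}. G_between S M G T (Suc t) r z * ?g r)"
    if "z \<in> space S" for z
    using step.IH that by simp
  have renewal: "future_weight (Suc t) (x (Suc t)) + future_weight (Suc t) (y (Suc t)) = renewal_weight (Suc t)"
    using step.hyps by (intro renewal_weight_from_future_weight[symmetric] IH) auto
  have M_z: "sets (M (Suc t) z) = sets S" "space (M (Suc t) z) = space S"
    using step.hyps step.prems by (auto intro!: M_prob)
  have meas: "G_between S M G T (Suc t) r \<in> borel_measurable (M (Suc t) z)" if "r \<in> {Suc t<..T + 1}" for r
    unfolding measurable_cong_sets[OF M_z(1) refl] using that by (intro measurable_G_between) auto
  have "(\<integral>\<^sup>+z'. future_weight (Suc t) z' \<partial>M (Suc t) z) =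
      (\<integral>\<^sup>+z'. (\<Sum>r\<in>{Suc t<..T + 1}. G_between S M G T (Suc t) r z' * ?g r) \<partial>M (Suc t) z)"
    using IH M_z(2) by (intro nn_integral_cong) auto
  also have "\<dots> = (\<Sum>r\<in>{Suc t<..T + 1}. (\<integral>\<^sup>+z'. G_between S M G T (Suc t) r z' \<partial>M (Suc t) z) * ?g r)"
    using meas by (subst nn_integral_sum) (auto simp: nn_integral_multc)
  finally have "future_weight t z = ennreal (G t z) * renewal_weight (Suc t) +
      (\<Sum>r\<in>{Suc t<..T + 1}. (ennreal (G t z) * (\<integral>\<^sup>+z'. G_between S M G T (Suc t) r z' \<partial>M (Suc t) z)) * (?c * ?g r))"
    unfolding future_weight_step[OF step.hyps(2)] renewal
    by (simp only: distrib_left sum_distrib_left ac_simps)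
  also have "(\<Sum>r\<in>{Suc t<..T + 1}. (ennreal (G t z) * (\<integral>\<^sup>+z'. G_between S M G T (Suc t) r z' \<partial>M (Suc t) z)) * (?c * ?g r)) =
      (\<Sum>r\<in>{Suc t<..T + 1}. G_between S M G T t r z * (?c ^ (r - t - 1) * renewal_weight r))"
  proof (rule sum.cong[OF refl])
    fix r assume r: "r \<in> {Suc t<..T + 1}"
    then have "r - t - 1 = Suc (r - Suc t - 1)"
      by auto
    then have "?c * ?g r = ?c ^ (r - t - 1) * renewal_weight r"
      by (simp only: power_Suc mult.assoc)
    moreover have "G_between S M G T t r z = ennreal (G t z) * (\<integral>\<^sup>+z'. G_between S M G T (Suc t) r z' \<partial>M (Suc t) z)"
      using G_between_first_step[of t r z] r step.prems by auto
    ultimately show "(ennreal (G t z) * (\<integral>\<^sup>+z'. G_between S M G T (Suc t) r z' \<partial>M (Suc t) z)) * (?c * ?g r) =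
        G_between S M G T t r z * (?c ^ (r - t - 1) * renewal_weight r)"
      by simp
  qed
  also have "ennreal (G t z) * renewal_weight (Suc t) =
      G_between S M G T t (Suc t) z * (?c ^ (Suc t - t - 1) * renewal_weight (Suc t))"
    using G_between_one_step[of t z] step by simp
  also have "\<dots> + (\<Sum>r\<in>{Suc t<..T + 1}. G_between S M G T t r z * (?c ^ (r - t - 1) * renewal_weight r)) =
      (\<Sum>r\<in>insert (Suc t) {Suc t<..T + 1}. G_between S M G T t r z * (?c ^ (r - t - 1) * renewal_weight r))"
    by (subst sum.insert) auto
  also have "insert (Suc t) {Suc t<..T + 1} = {t<..T + 1}"
    using step.hyps by auto
  finally show ?case .
qed

text \<open>
  The first generation behaves like one more free transition, from a time \<open>0\<close> with potential \<open>1\<close>: this is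
  why \<open>G_initial\<close> is one at index \<open>1\<close> and integrates \<open>G_between\<close> against \<open>M1\<close> at later indices.
\<close>

lemma initial_expectation_eq_sum:
  assumes "1 \<le> T"
  shows "future_weight 1 (x 1) + future_weight 1 (y 1) + of_nat (N - 2) * (\<integral>\<^sup>+z. future_weight 1 z \<partial>M1) =
    (\<Sum>q\<in>{1..T + 1}. G_initial S M1 M G T q * of_nat (N - 2) ^ (q - 1) * renewal_weight q)"
proof -
  let ?c = "of_nat (N - 2) :: ennreal"
  let ?g = "\<lambda>r. ?c ^ (r - 1 - 1) * renewal_weight r"
  have meas: "G_between S M G T 1 r \<in> borel_measurable M1" if "r \<in> {1<..T + 1}" for r
    unfolding measurable_cong_sets[OF sets_M1 refl] using that by (intro measurable_G_between) auto
  have "(\<integral>\<^sup>+z. future_weight 1 z \<partial>M1) = (\<integral>\<^sup>+z. (\<Sum>r\<in>{1<..T + 1}. G_between S M G T 1 r z * ?g r) \<partial>M1)"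
    using assms space_M1 by (intro nn_integral_cong future_weight_eq_sum) auto
  also have "\<dots> = (\<Sum>r\<in>{1<..T + 1}. (\<integral>\<^sup>+z. G_between S M G T 1 r z \<partial>M1) * ?g r)"
    using meas by (subst nn_integral_sum) (auto simp: nn_integral_multc)
  finally have "?c * (\<integral>\<^sup>+z. future_weight 1 z \<partial>M1) =
      (\<Sum>r\<in>{1<..T + 1}. ?c * ((\<integral>\<^sup>+z. G_between S M G T 1 r z \<partial>M1) * ?g r))"
    by (simp only: sum_distrib_left)
  also have "\<dots> = (\<Sum>r\<in>{1<..T + 1}. G_initial S M1 M G T r * ?c ^ (r - 1) * renewal_weight r)"
  proof (rule sum.cong[OF refl])
    fix r assume r: "r \<in> {1<..T + 1}"
    then have "r - 1 = Suc (r - 1 - 1)"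
      by auto
    then have "?c ^ (r - 1) = ?c * ?c ^ (r - 1 - 1)"
      by (metis power_Suc)
    then show "?c * ((\<integral>\<^sup>+z. G_between S M G T 1 r z \<partial>M1) * ?g r) =
        G_initial S M1 M G T r * ?c ^ (r - 1) * renewal_weight r"
      using r by (simp add: G_initial_eq_integral ac_simps)
  qed
  finally have integral: "?c * (\<integral>\<^sup>+z. future_weight 1 z \<partial>M1) =
      (\<Sum>r\<in>{1<..T + 1}. G_initial S M1 M G T r * ?c ^ (r - 1) * renewal_weight r)" .
  have first: "renewal_weight 1 = future_weight 1 (x 1) + future_weight 1 (y 1)"
    using assms by (intro renewal_weight_from_future_weight future_weight_eq_sum) auto
  have initial: "G_initial S M1 M G T 1 = 1"
    by (simp add: G_initial_def)
  have "{1..T + 1} = insert 1 {1<..T + 1}"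
    by auto
  then have "(\<Sum>q\<in>{1..T + 1}. G_initial S M1 M G T q * ?c ^ (q - 1) * renewal_weight q) =
      G_initial S M1 M G T 1 * ?c ^ (1 - 1) * renewal_weight 1 +
      (\<Sum>q\<in>{1<..T + 1}. G_initial S M1 M G T q * ?c ^ (q - 1) * renewal_weight q)"
    by (simp only: sum.insert finite_greaterThanAtMost greaterThanAtMost_iff less_irrefl simp_thms)
  also have "\<dots> = future_weight 1 (x 1) + future_weight 1 (y 1) + ?c * (\<integral>\<^sup>+z. future_weight 1 z \<partial>M1)"
    by (simp only: integral first initial diff_self_eq_0 power_0 mult_1_left)
  finally show ?thesis
    by (rule sym)
qed

end

section \<open>The expectation formula\<close>

theorem proposition9:
  fixes S M1 :: "'a measure"
    and M :: "nat \<Rightarrow> 'a \<Rightarrow> 'a measure"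
    and G :: "nat \<Rightarrow> 'a \<Rightarrow> real"
    and x y :: "nat \<Rightarrow> 'a"
    and T N :: nat
  assumes "T \<ge> 1"
    and "prob_space M1" and "sets M1 = sets S"
    and "\<And>t. t \<in> {2..T} \<Longrightarrow> M t \<in> S \<rightarrow>\<^sub>M prob_algebra S"
    and "\<And>t. t \<in> {1..T} \<Longrightarrow> G t \<in> borel_measurable S"
    and "\<And>t z. t \<in> {1..T} \<Longrightarrow> z \<in> space S \<Longrightarrow> 0 \<le> G t z"
    and "0 < G_initial S M1 M G T (T + 1)" and "G_initial S M1 M G T (T + 1) < \<infinity>"
    and "x \<in> {1..T} \<rightarrow> space S" and "y \<in> {1..T} \<rightarrow> space S"
    and "N \<ge> 2"
  shows "(\<integral>\<^sup>+(Z, A). ennreal (gamma_hat T N G Z) \<partial>c2smc_law T N S M1 M G x y) =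
    1 / of_nat N ^ T *
    (\<Sum>s\<in>{1..T + 1}. of_nat (N - 2) ^ (T + 1 - s) *
      (\<Sum>i\<in>index_chains T s. G_initial S M1 M G T (i 1) *
        (\<Prod>m\<in>{1..<s}. G_between S M G T (i m) (i (m + 1)) (x (i m)) +
                      G_between S M G T (i m) (i (m + 1)) (y (i m)))))"
proof -
  interpret doubly_conditional_smc S M1 M G T N x y
    by (intro doubly_conditional_smc.intro feynman_kac.intro doubly_conditional_smc_axioms.intro) (fact assms)+
  show ?thesis
    unfolding expected_gamma_hat[OF assms(1)] initial_expectation_eq_sum[OF assms(1)]
      sum_over_index_chains[where a = "G_initial S M1 M G T" and B = imposed_between] by (rule refl)
qed

end
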